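(* Let $u$ be a nonzero integer and consider the elliptic curve \[ E_u:\ y^2=x^3-9u^2x+12u^3 . \] Let $k$ be a positive integer such that $6\mid k$. Then: (i) For every prime $p$ at which $E_u$ has good reduction, $\gcd(A_p(E_u),k)\neq 1$; that is, the $k$-th Lattès map attached to $E_u$ is not arithmetically exceptional. (ii) If $P\in E_u(\overline{\mathbb{Q}})$ is a $k$-torsion point, then $x(P)\notin\mathbb{Q}$.
   Context: For an elliptic curve $E/\mathbb{Q}$ with good reduction at a prime $p$ and Frobenius trace $a_p=p+1-|E(\mathbb{F}_p)|$, put $A_p(E)=(p+1)^2-a_p^2$. Let $\mathrm{proj}:E\to\mathbb{P}^1$ be the $x$-coordinate projection (sending the point at infinity to $\infty$). For a positive integer $k$, the $k$-th Lattès map $L_k\in\mathbb{Q}(x)$ attached to $E$ is the unique rational function with $\mathrm{proj}\circ[k]=L_k\circ\mathrm{proj}$, where $[k]$ is multiplication by $k$ on $E$. A rational function $r(x)\in\mathbb{Q}(x)$ is called arithmetically exceptional if its reduction modulo $p$ (defined for all but finitely many primes $p$) induces a permutation of $\mathbb{P}^1(\mathbb{F}_p)$ for infinitely many primes $p$. A $k$-torsion point means a point $P\in E(\overline{\mathbb{Q}})$ with $[k]P$ equal to the point at infinity (not necessarily of exact order $k$); the point at infinity has $x$-coordinate $\infty\notin\mathbb{Q}$. *)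

theory Defs
  imports
    Complex_Main
    "HOL-Computational_Algebra.Computational_Algebra"
    "HOL-Number_Theory.Cong"
    "HOL-Number_Theory.Modular_Inverse"
begin

section \<open>Weierstrass curves and their group law\<close>

text \<open>
  Long Weierstrass equations \<open>y^2 + a1 x y + a3 y = x^3 + a2 x^2 + a4 x + a6\<close>.
  Even for a short equation over the rationals the long form is needed to define good
  reduction at 2 and 3.
\<close>

datatype 'a weierstrass =
  Weierstrass (wa1: 'a) (wa2: 'a) (wa3: 'a) (wa4: 'a) (wa6: 'a)

datatype 'a ec_point = PtInf | Pt 'a 'a

definition discriminant :: "'a::comm_ring_1 weierstrass \<Rightarrow> 'a" where
  "discriminant W =
     (let b2 = wa1 W ^ 2 + 4 * wa2 W;
          b4 = 2 * wa4 W + wa1 W * wa3 W;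
          b6 = wa3 W ^ 2 + 4 * wa6 W;
          b8 = wa1 W ^ 2 * wa6 W + 4 * wa2 W * wa6 W - wa1 W * wa3 W * wa4 W
               + wa2 W * wa3 W ^ 2 - wa4 W ^ 2
      in - (b2 ^ 2 * b8) - 8 * b4 ^ 3 - 27 * b6 ^ 2 + 9 * b2 * b4 * b6)"

fun on_curve :: "'a::field weierstrass \<Rightarrow> 'a ec_point \<Rightarrow> bool" where
  "on_curve W PtInf \<longleftrightarrow> True"
| "on_curve W (Pt x y) \<longleftrightarrow>
     y ^ 2 + wa1 W * x * y + wa3 W * y = x ^ 3 + wa2 W * x ^ 2 + wa4 W * x + wa6 W"

text \<open>
  The chord-tangent law.  The negative of \<open>(x, y)\<close> is \<open>(x, - y - a1 x - a3)\<close>; \<open>l\<close> is the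
  slope of the chord or tangent.  The formulas are meaningful only for points on the curve.
\<close>

fun ec_add :: "'a::field weierstrass \<Rightarrow> 'a ec_point \<Rightarrow> 'a ec_point \<Rightarrow> 'a ec_point" where
  "ec_add W PtInf Q = Q"
| "ec_add W P PtInf = P"
| "ec_add W (Pt x1 y1) (Pt x2 y2) =
     (if x1 = x2 \<and> y1 + y2 + wa1 W * x2 + wa3 W = 0 then PtInf
      else
        let l = (if x1 = x2
                 then (3 * x1 ^ 2 + 2 * wa2 W * x1 + wa4 W - wa1 W * y1)
                      / (2 * y1 + wa1 W * x1 + wa3 W)
                 else (y2 - y1) / (x2 - x1));
            x3 = l ^ 2 + wa1 W * l - wa2 W - x1 - x2
        in Pt x3 (- (l + wa1 W) * x3 - (y1 - l * x1) - wa3 W))"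

fun ec_mult :: "'a::field weierstrass \<Rightarrow> nat \<Rightarrow> 'a ec_point \<Rightarrow> 'a ec_point" where
  "ec_mult W 0 P = PtInf"
| "ec_mult W (Suc n) P = ec_add W P (ec_mult W n P)"

text \<open>
  The algebraic closure of the rationals is taken to be the field of algebraic complex numbers.
\<close>

abbreviation base_change :: "rat weierstrass \<Rightarrow> complex weierstrass" where
  "base_change W \<equiv> map_weierstrass of_rat W"

definition Qbar_points :: "rat weierstrass \<Rightarrow> complex ec_point set" where
  "Qbar_points W =
     insert PtInf {Pt x y | x y. algebraic x \<and> algebraic y \<and> on_curve (base_change W) (Pt x y)}"


section \<open>Good reduction and the Frobenius trace\<close>

text \<open>
  \<open>W'\<close> arises from \<open>W\<close> by \<open>x = v^2 x' + r\<close>, \<open>y = v^3 y' + s v^2 x' + t\<close>.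
\<close>

definition weierstrass_iso :: "'a::field weierstrass \<Rightarrow> 'a weierstrass \<Rightarrow> bool" where
  "weierstrass_iso W W' \<longleftrightarrow>
     (\<exists>v r s t. v \<noteq> 0 \<and>
        v * wa1 W' = wa1 W + 2 * s \<and>
        v ^ 2 * wa2 W' = wa2 W - s * wa1 W + 3 * r - s ^ 2 \<and>
        v ^ 3 * wa3 W' = wa3 W + r * wa1 W + 2 * t \<and>
        v ^ 4 * wa4 W' = wa4 W - s * wa3 W + 2 * r * wa2 W - (t + r * s) * wa1 W
                         + 3 * r ^ 2 - 2 * s * t \<and>
        v ^ 6 * wa6 W' = wa6 W + r * wa4 W + r ^ 2 * wa2 W + r ^ 3 - t * wa3 W
                         - t ^ 2 - r * t * wa1 W)"

text \<open>
  Asking for integral rather than merely \<open>p\<close>-integral coefficients loses nothing, since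
  denominators prime to \<open>p\<close> can be cleared by a scaling that changes the discriminant by a
  \<open>p\<close>-unit.  A model whose discriminant is a \<open>p\<close>-unit is automatically minimal at \<open>p\<close>.
\<close>

definition good_model :: "rat weierstrass \<Rightarrow> nat \<Rightarrow> int weierstrass \<Rightarrow> bool" where
  "good_model W p M \<longleftrightarrow>
     weierstrass_iso W (map_weierstrass of_int M) \<and> \<not> int p dvd discriminant M"

definition good_reduction :: "rat weierstrass \<Rightarrow> nat \<Rightarrow> bool" where
  "good_reduction W p \<longleftrightarrow> (\<exists>M. good_model W p M)"

definition points_mod :: "int weierstrass \<Rightarrow> nat \<Rightarrow> int ec_point set" where
  "points_mod M p =
     insert PtInf {Pt x y | x y. x \<in> {0..<int p} \<and> y \<in> {0..<int p} \<and>
       [y ^ 2 + wa1 M * x * y + wa3 M * y = x ^ 3 + wa2 M * x ^ 2 + wa4 M * x + wa6 M] (mod int p)}"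

text \<open>
  The number of points does not depend on the chosen model: two models that are good at \<open>p\<close>
  have isomorphic reductions.
\<close>

definition frobenius_trace :: "rat weierstrass \<Rightarrow> nat \<Rightarrow> int" where
  "frobenius_trace W p = int p + 1 - int (card (points_mod (SOME M. good_model W p M) p))"

definition A_at :: "rat weierstrass \<Rightarrow> nat \<Rightarrow> int" where
  "A_at W p = (int p + 1) ^ 2 - frobenius_trace W p ^ 2"


section \<open>Rational functions on the projective line\<close>

text \<open>
  A rational function over the rationals is an element of the fraction field of the ring of
  integer polynomials.  Then \<^const>\<open>quot_of_fract\<close> yields numerator and denominator
  that are coprime as integer polynomials, hence without a common constant
  factor, which is the representation to be reduced modulo primes.
\<close>

type_synonym ratfun = "int poly fract"

definition ratfun_num :: "ratfun \<Rightarrow> int poly" where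
  "ratfun_num r = fst (quot_of_fract r)"

definition ratfun_den :: "ratfun \<Rightarrow> int poly" where
  "ratfun_den r = snd (quot_of_fract r)"

definition ratfun_degree :: "ratfun \<Rightarrow> nat" where
  "ratfun_degree r = max (degree (ratfun_num r)) (degree (ratfun_den r))"

datatype 'a proj_line = Fin 'a | Infty

fun ratfun_eval :: "ratfun \<Rightarrow> 'a::field_char_0 proj_line \<Rightarrow> 'a proj_line" where
  "ratfun_eval r (Fin x) =
     (let a = poly (map_poly of_int (ratfun_num r)) x;
          b = poly (map_poly of_int (ratfun_den r)) x
      in if b = 0 then Infty else Fin (a / b))"
| "ratfun_eval r Infty =
     (let a = of_int (coeff (ratfun_num r) (ratfun_degree r));
          b = of_int (coeff (ratfun_den r) (ratfun_degree r))
      in if b = 0 then Infty else Fin (a / b))"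

text \<open>
  The reduction of \<open>r\<close> modulo \<open>p\<close> is defined if the homogenised numerator and denominator have
  no common zero on the projective line over an algebraic closure of the field with \<open>p\<close>
  elements: the first condition excludes common zeros at infinity, the second one (a Bezout
  identity modulo \<open>p\<close>) common finite zeros.
\<close>

definition ratfun_reduces :: "ratfun \<Rightarrow> nat \<Rightarrow> bool" where
  "ratfun_reduces r p \<longleftrightarrow>
     \<not> (int p dvd coeff (ratfun_num r) (ratfun_degree r) \<and>
        int p dvd coeff (ratfun_den r) (ratfun_degree r)) \<and>
     (\<exists>a b. [:int p:] dvd a * ratfun_num r + b * ratfun_den r - 1)"

definition proj_line_mod :: "nat \<Rightarrow> int proj_line set" where
  "proj_line_mod p = insert Infty (Fin ` {0..<int p})"

definition quotient_mod :: "nat \<Rightarrow> int \<Rightarrow> int \<Rightarrow> int proj_line" where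
  "quotient_mod p a b =
     (if int p dvd b then Infty else Fin ((a * modular_inverse (int p) b) mod int p))"

fun ratfun_eval_mod :: "nat \<Rightarrow> ratfun \<Rightarrow> int proj_line \<Rightarrow> int proj_line" where
  "ratfun_eval_mod p r (Fin x) = quotient_mod p (poly (ratfun_num r) x) (poly (ratfun_den r) x)"
| "ratfun_eval_mod p r Infty =
     quotient_mod p (coeff (ratfun_num r) (ratfun_degree r)) (coeff (ratfun_den r) (ratfun_degree r))"

definition arithmetically_exceptional :: "ratfun \<Rightarrow> bool" where
  "arithmetically_exceptional r \<longleftrightarrow>
     infinite {p. prime p \<and> ratfun_reduces r p \<and>
                  bij_betw (ratfun_eval_mod p r) (proj_line_mod p) (proj_line_mod p)}"


section \<open>Lattes maps\<close>

fun x_proj :: "'a ec_point \<Rightarrow> 'a proj_line" where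
  "x_proj PtInf = Infty"
| "x_proj (Pt x y) = Fin x"

text \<open>
  For every elliptic curve \<open>W\<close> and every \<open>k > 0\<close> there is exactly one such \<open>L\<close>.
\<close>

definition is_lattes_map :: "rat weierstrass \<Rightarrow> nat \<Rightarrow> ratfun \<Rightarrow> bool" where
  "is_lattes_map W k L \<longleftrightarrow>
     (\<forall>P \<in> Qbar_points W. x_proj (ec_mult (base_change W) k P) = ratfun_eval L (x_proj P))"


definition E_curve :: "int \<Rightarrow> rat weierstrass" where
  "E_curve u = Weierstrass 0 0 0 (- 9 * of_int u ^ 2) (12 * of_int u ^ 3)"

lemma discriminant_E_curve: "discriminant (E_curve u) = - (2 ^ 6 * 3 ^ 5 * of_int u ^ 6)"
  by (simp add: discriminant_def E_curve_def Let_def power_mult_distrib flip: power_mult)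

end

theory Submission
  imports Defs
begin

text \<open>
  Put \<open>f = x^3 - 9 x + 12\<close> and \<open>q = x^4 - 18 x^2 + 48 x - 27\<close>.  Up to the scaling \<open>x \<mapsto> u x\<close> the
  roots of \<open>f\<close> are the \<open>x\<close>-coordinates of the points of order 2 of \<open>E_u\<close>, and those of \<open>q\<close>
  are the \<open>x\<close>-coordinates of the points of order 3.

  The heart of the matter is that \<open>f\<close> or \<open>q\<close> has a root modulo every prime \<open>p > 3\<close>
  (\<open>cubic_or_quartic_root\<close>), although neither has a rational root.  The reason is that both
  polynomials are governed by the field generated by a cube root \<open>\<theta>\<close> of 3.  If 3 is a cube
  modulo \<open>p\<close>, then \<open>f\<close> has the root \<open>- (\<theta> + \<theta>^2)\<close>.  Otherwise \<open>\<theta>\<close> generates the field with \<open>p^3\<close>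
  elements; there \<open>3 + \<theta>^2\<close> has the square norm 36, so it is a square, and the trace of a
  suitably signed square root of it is a root of \<open>q\<close>.

  This settles both halves of (i).  A root of \<open>f\<close> modulo \<open>p\<close> makes the number \<open>N\<close> of points
  modulo \<open>p\<close> even.  A root of \<open>q\<close> modulo \<open>p\<close> gives a point of order 3 on the reduced curve or on
  its quadratic twist, so that 3 divides \<open>N\<close> or \<open>2 p + 2 - N\<close>.  As \<open>A_p = N (2 p + 2 - N)\<close>, the
  gcd of \<open>A_p\<close> and \<open>k\<close> is not 1 (\<open>A_at_not_coprime_6\<close>); the primes 2 and 3 are bad by a look at
  the invariants \<open>c4\<close> and \<open>c6\<close>.  For the Lattes map, all roots of \<open>f\<close> and of \<open>q\<close> are poles of \<open>L_k\<close>
  because 6 divides \<open>k\<close>, and so is infinity; hence for every \<open>p > 3\<close> the reduction of \<open>L_k\<close> maps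
  infinity and a root of \<open>f\<close> or \<open>q\<close> modulo \<open>p\<close> to the same point (\<open>lattes_not_exceptional\<close>).

  For (ii), doubling a point with rational \<open>x\<close> makes the denominator of \<open>x / u\<close> even, and every
  further doubling multiplies the exact power of 2 in it by 4.  So the points \<open>2^i P\<close> are
  pairwise different and \<open>P\<close> is not a torsion point (\<open>torsion_x_irrational\<close>).  To see that iterated
  doubling really computes \<open>2^i P\<close>, the associative law is needed in the single form
  \<open>(P + P) + R = P + (P + R)\<close> (\<open>ec_add_double_assoc\<close>).
\<close>


section \<open>Doubling on a short Weierstrass curve\<close>

lemma ec_add_inf_right: "ec_add W P PtInf = P"
  by (cases P) simp_all

text \<open>
  Characterising the slope by an equation instead of a quotient lets the formulas be used with
  whatever expression for the slope is at hand.
\<close>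

lemma ec_add_chord:
  fixes x1 :: "'a::field_char_0"
  assumes "x1 \<noteq> x2" and "l * (x2 - x1) = y2 - y1"
  shows "ec_add (Weierstrass 0 0 0 a b) (Pt x1 y1) (Pt x2 y2) =
    Pt (l ^ 2 - x1 - x2) (l * (2 * x1 + x2 - l ^ 2) - y1)"
proof -
  have "l = (y2 - y1) / (x2 - x1)"
    using assms by (simp add: field_simps)
  with assms(1) show ?thesis
    by (simp add: Let_def flip: \<open>l = _\<close>) (simp add: algebra_simps)
qed

lemma ec_add_tangent:
  fixes x :: "'a::field_char_0"
  assumes "y \<noteq> 0" and "2 * y * l = 3 * x ^ 2 + a"
  shows "ec_add (Weierstrass 0 0 0 a b) (Pt x y) (Pt x y) =
    Pt (l ^ 2 - 2 * x) (l * (3 * x - l ^ 2) - y)"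
proof -
  have "l = (3 * x ^ 2 + a) / (2 * y)"
    using assms by (simp add: field_simps)
  moreover have "y + y \<noteq> 0"
    using assms(1) by (simp flip: mult_2)
  ultimately show ?thesis
    by (simp add: Let_def flip: \<open>l = _\<close>) (simp add: algebra_simps)
qed

text \<open>
  The instance of associativity that is needed for \<open>2^i P\<close>.  It is far easier than the general
  law in coordinates adapted to the tangent line at \<open>P\<close>: write \<open>R = (x1 + X, y1 + s X + e)\<close> with
  \<open>s\<close> the slope of the tangent.  The equation of the curve becomes
  \<open>e^2 + 2 s X e + 2 y1 e = X^2 (X - X0)\<close>, where \<open>X0\<close> belongs to \<open>2 P\<close>.  Now the line through
  \<open>2 P\<close> and \<open>R\<close> has slope \<open>l1 = X^2 / e - s\<close>, the line through \<open>P\<close> and \<open>R\<close> has slope \<open>l2 = s + e / X\<close>,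
  and the line through \<open>P\<close> and \<open>P + R\<close> has slope \<open>l1 - e / X\<close>, so both sums are explicit.
\<close>

lemma ec_add_double_assoc:
  fixes x1 :: "'a::field_char_0"
  defines "W \<equiv> \<lambda>a b. Weierstrass 0 0 0 a (b::'a)"
  assumes P: "on_curve (W a b) (Pt x1 y1)" and "y1 \<noteq> 0" and R: "on_curve (W a b) R"
  shows "ec_add (W a b) (ec_add (W a b) (Pt x1 y1) (Pt x1 y1)) R =
    ec_add (W a b) (Pt x1 y1) (ec_add (W a b) (Pt x1 y1) R)"
proof -
  define s where "s = (3 * x1 ^ 2 + a) / (2 * y1)"
  have s: "2 * y1 * s = 3 * x1 ^ 2 + a"
    using \<open>y1 \<noteq> 0\<close> by (simp add: s_def)
  define X0 where "X0 = s ^ 2 - 3 * x1"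
  have PP: "ec_add (W a b) (Pt x1 y1) (Pt x1 y1) = Pt (x1 + X0) (- (y1 + s * X0))"
    unfolding W_def using ec_add_tangent[OF \<open>y1 \<noteq> 0\<close> s, of b]
    by (simp add: X0_def algebra_simps)
  show ?thesis
  proof (cases R)
    case PtInf
    then show ?thesis by (simp add: ec_add_inf_right)
  next
    case (Pt x2 y2)
    define X where "X = x2 - x1"
    define e where "e = y2 - y1 - s * X"
    have x2: "x2 = x1 + X" and y2: "y2 = y1 + s * X + e"
      by (simp_all add: X_def e_def)
    have P': "y1 ^ 2 = x1 ^ 3 + a * x1 + b" using P by (simp add: W_def)
    have R': "y2 ^ 2 = x2 ^ 3 + a * x2 + b" using R Pt by (simp add: W_def)
    have eq: "e ^ 2 + 2 * s * X * e + 2 * y1 * e = X ^ 2 * (X - X0)"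
      using P' R' s unfolding x2 y2 X0_def by algebra
    show ?thesis
    proof (cases "X = 0")
      case True
      then have "y2 ^ 2 = y1 ^ 2" using P' R' x2 by simp
      then have "y2 = y1 \<or> y2 = - y1" by (simp add: power2_eq_iff)
      then show ?thesis
      proof
        assume "y2 = y1"
        then have RP: "R = Pt x1 y1" using Pt True x2 by simp
        show ?thesis
        proof (cases "X0 = 0")
          case True
          then show ?thesis unfolding RP PP by (simp add: W_def)
        next
          case False
          define m where "m = - (2 * y1 + s * X0) / X0"
          have m: "m * X0 = - (2 * y1 + s * X0)" using False by (simp add: m_def)
          have "ec_add (W a b) (Pt (x1 + X0) (- (y1 + s * X0))) (Pt x1 y1) =
            Pt (m ^ 2 - (x1 + X0) - x1) (m * (2 * (x1 + X0) + x1 - m ^ 2) - (- (y1 + s * X0)))"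
            unfolding W_def by (rule ec_add_chord) (use False m in auto)
          moreover have "ec_add (W a b) (Pt x1 y1) (Pt (x1 + X0) (- (y1 + s * X0))) =
            Pt (m ^ 2 - x1 - (x1 + X0)) (m * (2 * x1 + (x1 + X0) - m ^ 2) - y1)"
            unfolding W_def by (rule ec_add_chord) (use False m in auto)
          moreover have "m * (2 * (x1 + X0) + x1 - m ^ 2) - (- (y1 + s * X0)) =
            m * (2 * x1 + (x1 + X0) - m ^ 2) - y1"
            using m by algebra
          ultimately show ?thesis unfolding RP PP by simp
        qed
      next
        assume "y2 = - y1"
        then have RP: "R = Pt x1 (- y1)" using Pt True x2 by simp
        have "ec_add (W a b) (Pt (x1 + X0) (- (y1 + s * X0))) (Pt x1 (- y1)) = Pt x1 y1"
        proof (cases "X0 = 0")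
          case True
          have "2 * (- y1) * (- s) = 3 * x1 ^ 2 + a" using s by simp
          from ec_add_tangent[OF _ this, of b] \<open>y1 \<noteq> 0\<close> True show ?thesis
            by (simp add: W_def X0_def algebra_simps)
        next
          case False
          have "ec_add (W a b) (Pt (x1 + X0) (- (y1 + s * X0))) (Pt x1 (- y1)) =
            Pt ((- s) ^ 2 - (x1 + X0) - x1)
              ((- s) * (2 * (x1 + X0) + x1 - (- s) ^ 2) - (- (y1 + s * X0)))"
            unfolding W_def by (rule ec_add_chord) (use False in \<open>simp_all add: algebra_simps\<close>)
          then show ?thesis by (simp add: X0_def algebra_simps)
        qed
        then show ?thesis unfolding RP PP
          by (simp add: W_def)
      qed
    next
      case X: False
      define l2 where "l2 = s + e / X"
      have l2X: "l2 * X = s * X + e" using X by (simp add: l2_def field_simps)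
      define U where "U = l2 ^ 2 - 3 * x1 - X"
      have U: "U * X ^ 2 = - 2 * y1 * e"
      proof -
        have "U * X ^ 2 = (l2 * X) ^ 2 - 3 * x1 * X ^ 2 - X ^ 3"
          unfolding U_def by algebra
        also have "\<dots> = - 2 * y1 * e"
          unfolding l2X using eq unfolding X0_def by algebra
        finally show ?thesis .
      qed
      have PR: "ec_add (W a b) (Pt x1 y1) R = Pt (x1 + U) (- (y1 + l2 * U))"
        unfolding Pt W_def
        by (subst ec_add_chord[where l = l2])
          (use X l2X in \<open>simp_all add: x2 y2 U_def algebra_simps power2_eq_square\<close>)
      show ?thesis
      proof (cases "e = 0")
        case True
        \<comment> \<open>Here \<open>R = - 2 P\<close>, so both sums are the point at infinity.\<close>
        then have "U = 0" using U X by simp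
        moreover have "X = X0" using eq X True by simp
        ultimately show ?thesis unfolding PR PP unfolding Pt x2 y2 True
          by (simp add: W_def)
      next
        case e: False
        define l1 where "l1 = X ^ 2 / e - s"
        have l1: "l1 * e = X ^ 2 - s * e" using e by (simp add: l1_def field_simps)
        have U0: "U \<noteq> 0" using U e \<open>y1 \<noteq> 0\<close> X by auto
        have lhs: "ec_add (W a b) (Pt (x1 + X0) (- (y1 + s * X0))) (Pt x2 y2) =
          Pt (l1 ^ 2 - (x1 + X0) - x2) (l1 * (2 * (x1 + X0) + x2 - l1 ^ 2) + (y1 + s * X0))"
        proof (cases "X = X0")
          case True
          have "e * (e + 2 * s * X + 2 * y1) = X ^ 2 * (X - X0)" using eq by algebra
          then have "e + (2 * s * X + 2 * y1) = 0" using e True by (simp add: add.assoc)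
          then have "e = - (2 * s * X + 2 * y1)" by (simp only: eq_neg_iff_add_eq_0)
          then have e': "e = - 2 * (y1 + s * X)" by algebra
          then have y2': "y2 = - (y1 + s * X)" and "2 * y2 = e"
            using y2 by algebra+
          have "2 * y2 * l1 = X ^ 2 - s * e" using l1 \<open>2 * y2 = e\<close> by (simp add: mult.commute)
          also have "\<dots> = 3 * x2 ^ 2 + a + 2 * X * (X0 - X) + (2 * y1 * s - (3 * x1 ^ 2 + a))"
            unfolding e' x2 X0_def by (simp add: algebra_simps power2_eq_square)
          also have "\<dots> = 3 * x2 ^ 2 + a" using True s by simp
          finally have "2 * y2 * l1 = 3 * x2 ^ 2 + a" .
          moreover have "y2 \<noteq> 0" using \<open>2 * y2 = e\<close> e by auto
          ultimately have "ec_add (W a b) (Pt x2 y2) (Pt x2 y2) =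
              Pt (l1 ^ 2 - 2 * x2) (l1 * (3 * x2 - l1 ^ 2) - y2)"
            unfolding W_def by (intro ec_add_tangent)
          moreover have "x1 + X0 = x2" and "y1 + s * X0 = - y2"
            using True x2 y2' by simp_all
          moreover have "l1 ^ 2 - x2 - x2 = l1 ^ 2 - 2 * x2"
            and "l1 * (2 * x2 + x2 - l1 ^ 2) + - y2 = l1 * (3 * x2 - l1 ^ 2) - y2"
            by algebra+
          ultimately show ?thesis by (simp only: minus_minus)
        next
          case False
          have "e * (l1 * (X - X0)) = e * (y2 + y1 + s * X0)"
          proof -
            have "e * (l1 * (X - X0)) = (X ^ 2 - s * e) * (X - X0)"
              using l1 by algebra
            also have "\<dots> = e * (y2 + y1 + s * X0)"
              using eq y2 by algebra
            finally show ?thesis .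
          qed
          then have "l1 * (X - X0) = y2 + y1 + s * X0" using e by simp
          then show ?thesis unfolding W_def
            by (subst ec_add_chord[where l = l1]) (use False x2 in auto)
        qed
        define l3 where "l3 = l1 - e / X"
        have l3': "l3 = X ^ 2 / e - l2" by (simp add: l3_def l1_def l2_def)
        have "X ^ 2 * (l3 * U) = X ^ 2 * (- 2 * y1 - l2 * U)"
        proof -
          have "X ^ 2 * (l3 * U) = l3 * (- 2 * y1 * e)" using U by algebra
          also have "\<dots> = - 2 * y1 * (X ^ 2 - l2 * e)" using e by (simp add: l3' field_simps)
          also have "\<dots> = X ^ 2 * (- 2 * y1 - l2 * U)" using U by algebra
          finally show ?thesis .
        qed
        \<comment> \<open>The defining equation for the slope of the line through \<open>P\<close> and \<open>P + R\<close>, where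
          \<open>P + R\<close> is the point \<open>(x1 + U, - (y1 + l2 U))\<close>.\<close>
        then have l3U: "l3 * U = - 2 * y1 - l2 * U" using X by simp
        have rhs: "ec_add (W a b) (Pt x1 y1) (Pt (x1 + U) (- (y1 + l2 * U))) =
          Pt (l3 ^ 2 - x1 - (x1 + U)) (l3 * (2 * x1 + (x1 + U) - l3 ^ 2) - y1)"
          unfolding W_def
          by (rule ec_add_chord) (use U0 l3U in auto)
        define t where "t = e / X"
        have tX: "t * X = e" using X by (simp add: t_def)
        have l2t: "l2 = s + t" and l3t: "l3 = l1 - t"
          by (simp_all add: l2_def l3_def t_def)
        have l1t: "l1 * t = X - s * t"
        proof -
          have "X * (l1 * t) = X * (X - s * t)" using l1 tX by algebra
          then show ?thesis using X by simp
        qed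
        have x3: "l3 ^ 2 - x1 - (x1 + U) = l1 ^ 2 - (x1 + X0) - x2"
          using l1t unfolding l3t U_def l2t X0_def x2 by algebra
        have y3: "l3 * (2 * x1 + (x1 + U) - l3 ^ 2) - y1
          = l1 * (2 * (x1 + X0) + x2 - l1 ^ 2) + (y1 + s * X0)"
        proof -
          have "l3 * (2 * x1 + (x1 + U) - l3 ^ 2) - y1 =
              - l3 * (l3 ^ 2 - x1 - (x1 + U)) + l3 * x1 - y1"
            by algebra
          also have "\<dots> = - l3 * (l1 ^ 2 - (x1 + X0) - x2) + l3 * x1 - y1"
            unfolding x3 ..
          also have "\<dots> = l1 * (2 * (x1 + X0) + x2 - l1 ^ 2) + (y1 + s * X0)"
            using l1t l3U unfolding l3t l2t X0_def x2 U_def by algebra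
          finally show ?thesis .
        qed
        show ?thesis unfolding PP PR unfolding Pt lhs rhs x3 y3 ..
      qed
    qed
  qed
qed

lemma ec_add_tangent_on_curve:
  fixes x :: "'a::field_char_0"
  assumes "on_curve (Weierstrass 0 0 0 a b) (Pt x y)" and "y \<noteq> 0" and "2 * y * l = 3 * x ^ 2 + a"
  shows "on_curve (Weierstrass 0 0 0 a b) (Pt (l ^ 2 - 2 * x) (l * (3 * x - l ^ 2) - y))"
proof -
  have "y ^ 2 = x ^ 3 + a * x + b" using assms(1) by simp
  then have "(l * (3 * x - l ^ 2) - y) ^ 2 = (l ^ 2 - 2 * x) ^ 3 + a * (l ^ 2 - 2 * x) + b"
    using assms(3) by algebra
  then show ?thesis by simp
qed

lemma ec_add_on_curve:
  fixes a b :: "'a::field_char_0"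
  assumes P: "on_curve (Weierstrass 0 0 0 a b) P" and Q: "on_curve (Weierstrass 0 0 0 a b) Q"
  shows "on_curve (Weierstrass 0 0 0 a b) (ec_add (Weierstrass 0 0 0 a b) P Q)"
proof (cases P)
  case PtInf
  then show ?thesis using Q by simp
next
  case P': (Pt x1 y1)
  show ?thesis
  proof (cases Q)
    case PtInf
    then show ?thesis using P by (simp add: ec_add_inf_right)
  next
    case Q': (Pt x2 y2)
    have e1: "y1 ^ 2 = x1 ^ 3 + a * x1 + b" and e2: "y2 ^ 2 = x2 ^ 3 + a * x2 + b"
      using P Q P' Q' by simp_all
    show ?thesis
    proof (cases "x1 = x2")
      case True
      then have "y2 ^ 2 = y1 ^ 2" using e1 e2 by simp
      then consider "y2 = - y1" | "y2 = y1" "y1 \<noteq> 0"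
        by (cases "y1 = 0") (auto simp: power2_eq_iff)
      then show ?thesis
      proof cases
        case 1
        then show ?thesis using True P' Q' by simp
      next
        case 2
        have l: "2 * y1 * ((3 * x1 ^ 2 + a) / (2 * y1)) = 3 * x1 ^ 2 + a" using 2 by simp
        show ?thesis unfolding P' Q' 2 True[symmetric] ec_add_tangent[OF 2(2) l]
          using P ec_add_tangent_on_curve[OF _ 2(2) l] unfolding P' by blast
      qed
    next
      case False
      define l where "l = (y2 - y1) / (x2 - x1)"
      have l: "l * (x2 - x1) = y2 - y1" using False by (simp add: l_def)
      have "(x2 - x1) * (l * (y1 + y2)) = (x2 - x1) * (x1 ^ 2 + x1 * x2 + x2 ^ 2 + a)"
        using l e1 e2 by algebra
      then have "l * (y1 + y2) = x1 ^ 2 + x1 * x2 + x2 ^ 2 + a" using False by simp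
      then have "(l * (2 * x1 + x2 - l ^ 2) - y1) ^ 2
        = (l ^ 2 - x1 - x2) ^ 3 + a * (l ^ 2 - x1 - x2) + b"
        using l e1 by algebra
      then show ?thesis unfolding P' Q' ec_add_chord[OF False l] by simp
    qed
  qed
qed

lemma ec_mult_on_curve:
  fixes a b :: "'a::field_char_0"
  assumes "on_curve (Weierstrass 0 0 0 a b) P"
  shows "on_curve (Weierstrass 0 0 0 a b) (ec_mult (Weierstrass 0 0 0 a b) n P)"
  by (induction n) (simp_all add: ec_add_on_curve assms)

lemma ec_mult_double:
  fixes a b :: "'a::field_char_0"
  assumes P: "on_curve (Weierstrass 0 0 0 a b) (Pt x y)" and y: "y \<noteq> 0"
  shows "ec_mult (Weierstrass 0 0 0 a b) (2 * m) (Pt x y) =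
    ec_mult (Weierstrass 0 0 0 a b) m (ec_add (Weierstrass 0 0 0 a b) (Pt x y) (Pt x y))"
proof (induction m)
  case (Suc m)
  have "2 * Suc m = Suc (Suc (2 * m))" by simp
  then show ?case
    by (simp only: ec_mult.simps Suc
        ec_add_double_assoc[OF P y ec_mult_on_curve[OF ec_add_on_curve[OF P P]]])
qed simp

lemma ec_mult_mod:
  assumes "ec_mult W k P = PtInf"
  shows "ec_mult W n P = ec_mult W (n mod k) P"
proof -
  have period: "ec_mult W (n + k) P = ec_mult W n P" for n
    by (induction n) (simp_all add: assms)
  have "ec_mult W (r + m * k) P = ec_mult W r P" for r m
  proof (induction m)
    case (Suc m)
    then show ?case using period[of "r + m * k"] by (simp add: algebra_simps)
  qed simp
  from this[of "n mod k" "n div k"] show ?thesis by simp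
qed

section \<open>Rational points and the prime 2\<close>

text \<open>
  The effect of doubling on \<open>x / u\<close>; it does not depend on \<open>u\<close>.
\<close>

definition double_x :: "rat \<Rightarrow> rat" where
  "double_x t = (t ^ 4 + 18 * t ^ 2 - 96 * t + 81) / (4 * (t ^ 3 - 9 * t + 12))"

text \<open>
  The 2-adic valuation of \<open>t\<close> is \<open>- j\<close>.
\<close>

definition two_pole :: "nat \<Rightarrow> rat \<Rightarrow> bool" where
  "two_pole j t \<longleftrightarrow> (\<exists>a b. odd a \<and> odd b \<and> t = of_int a / (2 ^ j * of_int b))"

lemma two_pole_unique:
  assumes "two_pole i t" and "two_pole j t"
  shows "i = j"
proof -
  have False if "two_pole i t" "two_pole j t" and ij: "i < j" for i j
  proof -
    from that obtain a b c d where *: "odd a" "odd b" "odd c" "odd d"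
      "t = of_int a / (2 ^ i * of_int b)" "t = of_int c / (2 ^ j * of_int d)"
      unfolding two_pole_def by auto
    have "b \<noteq> 0" "d \<noteq> 0" using * by auto
    with *(5,6) have "(of_int (a * (2 ^ j * d)) :: rat) = of_int (c * (2 ^ i * b))"
      by (simp add: field_simps)
    then have eq: "a * (2 ^ j * d) = c * (2 ^ i * b)" by (simp only: of_int_eq_iff)
    obtain m where "j = i + Suc m" using ij less_imp_Suc_add by auto
    then have "2 ^ i * (2 * (a * 2 ^ m * d)) = (2::int) ^ i * (c * b)"
      using eq by (simp add: power_add mult_ac)
    then have "2 * (a * 2 ^ m * d) = c * b" by simp
    moreover have "odd (c * b)" using * by simp
    ultimately show False by (metis dvd_triv_left)
  qed
  then show ?thesis using assms by (meson linorder_neqE_nat)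
qed

lemma double_x_fraction:
  assumes "d \<noteq> (0::int)"
  shows "double_x (of_int a / of_int d) =
      of_int (a ^ 4 + 18 * a ^ 2 * d ^ 2 - 96 * a * d ^ 3 + 81 * d ^ 4) /
      of_int (4 * d * (a ^ 3 - 9 * a * d ^ 2 + 12 * d ^ 3))" (is "?l = of_int ?n / of_int (4 * d * ?f)")
proof -
  define x :: rat where "x = of_int a"
  define y :: rat where "y = of_int d"
  have y: "y \<noteq> 0" using assms by (simp add: y_def)
  have "(x / y) ^ 4 + 18 * (x / y) ^ 2 - 96 * (x / y) + 81 =
    (x ^ 4 + 18 * x ^ 2 * y ^ 2 - 96 * x * y ^ 3 + 81 * y ^ 4) / y ^ 4"
    using y by (simp add: field_simps power2_eq_square power3_eq_cube power4_eq_xxxx)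
  moreover have "(x / y) ^ 3 - 9 * (x / y) + 12 = (x ^ 3 - 9 * x * y ^ 2 + 12 * y ^ 3) / y ^ 3"
    using y by (simp add: field_simps power2_eq_square power3_eq_cube power4_eq_xxxx)
  moreover have "A / y ^ 4 / (4 * (B / y ^ 3)) = A / (4 * y * B)" for A B
    using y by (simp add: field_simps power2_eq_square power3_eq_cube power4_eq_xxxx)
  ultimately have "double_x (x / y) =
    (x ^ 4 + 18 * x ^ 2 * y ^ 2 - 96 * x * y ^ 3 + 81 * y ^ 4) /
    (4 * y * (x ^ 3 - 9 * x * y ^ 2 + 12 * y ^ 3))"
    unfolding double_x_def by (simp only:)
  then show ?thesis by (simp add: x_def y_def)
qed

text \<open>
  If 2 divides the denominator \<open>d\<close> of \<open>t = a / d\<close>, then all terms but the leading ones are even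
  in the numerator and in the cubic factor of the denominator of \<open>double_x t\<close>; only the factor
  \<open>4 d\<close> contributes to the valuation.
\<close>

lemma two_pole_double_x:
  assumes "two_pole j t" and "j > 0"
  shows "two_pole (j + 2) (double_x t)"
proof -
  obtain a b where ab: "odd a" "odd b" "t = of_int a / (2 ^ j * of_int b)"
    using assms(1) unfolding two_pole_def by auto
  define d where "d = 2 ^ j * b"
  have "even d" "d \<noteq> 0" using assms(2) ab by (auto simp: d_def)
  define n f where "n = a ^ 4 + 18 * a ^ 2 * d ^ 2 - 96 * a * d ^ 3 + 81 * d ^ 4"
    and "f = a ^ 3 - 9 * a * d ^ 2 + 12 * d ^ 3"
  have odd: "odd n" "odd f" using ab(1) \<open>even d\<close> by (simp_all add: n_def f_def)
  have "double_x t = of_int n / of_int (4 * d * f)"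
    using double_x_fraction[OF \<open>d \<noteq> 0\<close>, of a] ab(3) by (simp add: d_def n_def f_def)
  also have "4 * d * f = 2 ^ (j + 2) * (b * f)" by (simp add: d_def power_add)
  finally have "double_x t = of_int n / (2 ^ (j + 2) * of_int (b * f))" by simp
  with odd ab(2) show ?thesis unfolding two_pole_def by (metis even_mult_iff)
qed

lemma no_rational_two_torsion:
  assumes "coprime a d" and "d \<noteq> (0::int)"
  shows "a ^ 3 - 9 * a * d ^ 2 + 12 * d ^ 3 \<noteq> 0"
proof
  assume eq: "a ^ 3 - 9 * a * d ^ 2 + 12 * d ^ 3 = 0"
  then have "a ^ 3 = 3 * (3 * a * d ^ 2 - 4 * d ^ 3)" by algebra
  then have "3 dvd a ^ 3" by (metis dvd_triv_left)
  moreover have p3: "prime (3::int)" by simp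
  ultimately have "3 dvd a" using prime_dvd_power by blast
  then obtain c where c: "a = 3 * c" by blast
  then have "3 * (3 * (c ^ 3 * 3 - 3 * c * d ^ 2 + d ^ 3)) = - (3 * d ^ 3)"
    using eq by algebra
  then have "d ^ 3 = 3 * - (c ^ 3 * 3 - 3 * c * d ^ 2 + d ^ 3)" by simp
  then have "3 dvd d ^ 3" by (metis dvd_triv_left)
  then have "3 dvd d" using prime_dvd_power p3 by blast
  with \<open>3 dvd a\<close> assms(1) have "is_unit (3::int)" by (meson coprime_common_divisor)
  then show False by simp
qed

lemma rat_two_torsion_free: "t ^ 3 - 9 * t + 12 \<noteq> (0::rat)"
proof -
  obtain a d where ad: "coprime a d" "d > 0" "t = of_int a / of_int d"
    by (metis quotient_of_coprime quotient_of_denom_pos quotient_of_div surj_pair)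
  define x y :: rat where "x = of_int a" and "y = of_int d"
  have "y \<noteq> 0" using ad by (simp add: y_def)
  have "t ^ 3 - 9 * t + 12 = (x ^ 3 - 9 * x * y ^ 2 + 12 * y ^ 3) / y ^ 3"
    using \<open>y \<noteq> 0\<close> unfolding ad(3) x_def[symmetric] y_def[symmetric]
    by (simp add: field_simps power2_eq_square power3_eq_cube)
  also have "x ^ 3 - 9 * x * y ^ 2 + 12 * y ^ 3 = of_int (a ^ 3 - 9 * a * d ^ 2 + 12 * d ^ 3)"
    by (simp add: x_def y_def)
  also have "\<dots> \<noteq> 0"
    unfolding of_int_eq_0_iff using no_rational_two_torsion[OF ad(1)] ad(2) by simp
  then have "of_int (a ^ 3 - 9 * a * d ^ 2 + 12 * d ^ 3) / y ^ 3 \<noteq> 0"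
    unfolding divide_eq_0_iff using \<open>y \<noteq> 0\<close> by (metis power_not_zero)
  finally show ?thesis .
qed

text \<open>
  One doubling always produces a pole at 2.  Modulo powers of 2, the delicate case is that of odd
  numerator and denominator: there the numerator and the cubic factor are both exactly divisible
  by 4, and the additional factor 4 of the denominator survives.
\<close>

lemma two_pole_double_x_start: "\<exists>j>0. two_pole j (double_x t)"
proof -
  obtain a d where ad: "coprime a d" "d > 0" "t = of_int a / of_int d"
    by (metis quotient_of_coprime quotient_of_denom_pos quotient_of_div surj_pair)
  have d0: "d \<noteq> 0" using ad by simp
  define n f where "n = a ^ 4 + 18 * a ^ 2 * d ^ 2 - 96 * a * d ^ 3 + 81 * d ^ 4"
    and "f = a ^ 3 - 9 * a * d ^ 2 + 12 * d ^ 3"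
  have f0: "f \<noteq> 0" unfolding f_def using ad by (intro no_rational_two_torsion) auto
  have eq: "double_x t = of_int n / of_int (4 * d * f)"
    unfolding ad(3) n_def f_def by (rule double_x_fraction[OF d0])
  consider "even d" | "odd d" "even a" | "odd d" "odd a" by blast
  then show ?thesis
  proof cases
    case 1
    then have "odd a" using ad(1) coprime_common_divisor by fastforce
    obtain m e where me: "d = 2 ^ m * e" "odd e"
      using multiplicity_decompose'[OF d0, of 2] by (metis odd_one)
    have "m > 0" using 1 me by (cases m) auto
    have "two_pole m t" unfolding two_pole_def using \<open>odd a\<close> me ad(3) by auto
    from two_pole_double_x[OF this \<open>m > 0\<close>] show ?thesis
      by (metis add_2_eq_Suc' zero_less_Suc)
  next
    case 2
    obtain m e where me: "f = 2 ^ m * e" "odd e"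
      using multiplicity_decompose'[OF f0, of 2] by (metis odd_one)
    have "odd n" using 2 by (simp add: n_def)
    moreover have "4 * d * f = 2 ^ (m + 2) * (d * e)" by (simp add: me power_add)
    ultimately have "two_pole (m + 2) (double_x t)"
      unfolding two_pole_def eq using 2 me by (intro exI[of _ n] exI[of _ "d * e"]) simp
    then show ?thesis by (metis add_2_eq_Suc' zero_less_Suc)
  next
    case 3
    obtain x where x: "a = 2 * x + 1" using 3 by (elim oddE)
    obtain y where y: "d = 2 * y + 1" using 3 by (elim oddE)
    \<comment> \<open>Squares of odd numbers are 1 modulo 8, whence numerator and cubic are 4 modulo 8.\<close>
    have "even (x * (x + 1))" "even (y * (y + 1))" by simp_all
    then obtain A B where "x * (x + 1) = 2 * A" "y * (y + 1) = 2 * B" by (elim dvdE)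
    then have sq: "a ^ 2 = 8 * A + 1" "d ^ 2 = 8 * B + 1" unfolding x y by algebra+
    have "n = 4 * (2 * (8 * A ^ 2 + 2 * A + 18 * (8 * A * B + A + B) - 12 * a * d * (8 * B + 1)
        + 81 * (8 * B ^ 2 + 2 * B) + 12) + 1)"
      using sq unfolding n_def by algebra
    moreover have "f = 4 * (2 * (a * A - a - 9 * a * B + 12 * d * B + 3 * y + 1) + 1)"
      using sq y unfolding f_def by algebra
    ultimately obtain k m where km: "n = 4 * (2 * k + 1)" "f = 4 * (2 * m + 1)" by blast
    have "double_x t = of_int (2 * k + 1) / (2 ^ 2 * of_int (d * (2 * m + 1)))"
    proof -
      have "(4 * P) / (4 * D * (4 * Q)) = P / (4 * (D * Q))" for P D Q :: rat by simp
      then show ?thesis unfolding eq km by (simp only: of_int_mult of_int_numeral) simp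
    qed
    then have "two_pole 2 (double_x t)"
      unfolding two_pole_def using 3 by (intro exI[of _ "2 * k + 1"] exI[of _ "d * (2 * m + 1)"]) simp
    then show ?thesis by (metis zero_less_numeral)
  qed
qed

lemma base_change_E_curve:
  "base_change (E_curve u) =
    Weierstrass 0 0 0 (of_rat (- 9 * of_int u ^ 2)) (of_rat (12 * of_int u ^ 3))"
  by (simp add: E_curve_def)

lemma ec_double_rational_x:
  fixes u :: int and t :: rat and y :: complex
  assumes "u \<noteq> 0" and P: "on_curve (base_change (E_curve u)) (Pt (of_rat (of_int u * t)) y)"
  obtains y' where
    "ec_add (base_change (E_curve u)) (Pt (of_rat (of_int u * t)) y) (Pt (of_rat (of_int u * t)) y) =
      Pt (of_rat (of_int u * double_x t)) y'"
    "on_curve (base_change (E_curve u)) (Pt (of_rat (of_int u * double_x t)) y')"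
    "y \<noteq> 0"
proof -
  define v T :: complex where "v = of_int u" and "T = of_rat t"
  have v0: "v \<noteq> 0" using assms(1) by (simp add: v_def)
  have W: "base_change (E_curve u) = Weierstrass 0 0 0 (- 9 * v ^ 2) (12 * v ^ 3)"
    by (simp add: base_change_E_curve v_def of_rat_mult of_rat_power of_rat_minus)
  have x: "of_rat (of_int u * t) = v * T" by (simp add: v_def T_def of_rat_mult)
  define f where "f = T ^ 3 - 9 * T + 12"
  have "f = of_rat (t ^ 3 - 9 * t + 12)"
    by (simp add: f_def T_def of_rat_mult of_rat_power of_rat_add of_rat_diff)
  then have f0: "f \<noteq> 0" using rat_two_torsion_free[of t] by simp
  have P': "y ^ 2 = v ^ 3 * f"
    using P unfolding W x by (simp add: f_def algebra_simps power2_eq_square power3_eq_cube)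
  then have y0: "y \<noteq> 0" using v0 f0 by auto
  define l where "l = 3 * v ^ 2 * (T ^ 2 - 3) / (2 * y)"
  have l: "2 * y * l = 3 * (v * T) ^ 2 + - 9 * v ^ 2"
  proof -
    have "2 * y * l = 3 * v ^ 2 * (T ^ 2 - 3)" using y0 by (simp add: l_def)
    then show ?thesis by algebra
  qed
  define g where "g = (T ^ 4 + 18 * T ^ 2 - 96 * T + 81) / (4 * f)"
  have g: "of_rat (double_x t) = g"
    by (simp add: double_x_def g_def f_def T_def of_rat_mult of_rat_power of_rat_add of_rat_diff of_rat_divide)
  have "(2 * y) ^ 2 * (l ^ 2 - 2 * (v * T)) = (2 * y) ^ 2 * (v * g)"
  proof -
    have "(2 * y) ^ 2 * (l ^ 2 - 2 * (v * T)) = (2 * y * l) ^ 2 - 8 * v * T * y ^ 2"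
      by algebra
    also have "\<dots> = v ^ 4 * (9 * (T ^ 2 - 3) ^ 2 - 8 * T * f)"
      unfolding l P' by algebra
    also have "\<dots> = v ^ 4 * (4 * f * g)"
    proof -
      have "4 * f * g = T ^ 4 + 18 * T ^ 2 - 96 * T + 81" using f0 by (simp add: g_def)
      also have "\<dots> = 9 * (T ^ 2 - 3) ^ 2 - 8 * T * f" unfolding f_def by algebra
      finally show ?thesis by simp
    qed
    also have "\<dots> = (2 * y) ^ 2 * (v * g)"
      using P' by algebra
    finally show ?thesis .
  qed
  then have xx: "l ^ 2 - 2 * (v * T) = v * g" using y0 by simp
  have xx': "v * g = of_rat (of_int u * double_x t)" by (simp add: g of_rat_mult v_def)
  show ?thesis
  proof
    show "ec_add (base_change (E_curve u)) (Pt (of_rat (of_int u * t)) y) (Pt (of_rat (of_int u * t)) y)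
      = Pt (of_rat (of_int u * double_x t)) (l * (3 * (v * T) - l ^ 2) - y)"
      unfolding W x ec_add_tangent[OF y0 l] xx xx' ..
    have "on_curve (Weierstrass 0 0 0 (- 9 * v ^ 2) (12 * v ^ 3)) (Pt (v * T) y)"
      using P unfolding W x .
    from ec_add_tangent_on_curve[OF this y0 l]
    show "on_curve (base_change (E_curve u)) (Pt (of_rat (of_int u * double_x t))
        (l * (3 * (v * T) - l ^ 2) - y))"
      unfolding W xx xx' .
    show "y \<noteq> 0" by fact
  qed
qed

lemma ec_mult_pow2_rational_x:
  assumes "u \<noteq> 0" and "on_curve (base_change (E_curve u)) (Pt (of_rat (of_int u * t)) y)"
  shows "\<exists>y'. ec_mult (base_change (E_curve u)) (2 ^ i) (Pt (of_rat (of_int u * t)) y) =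
    Pt (of_rat (of_int u * (double_x ^^ i) t)) y'"
  using assms(2)
proof (induction i arbitrary: t y)
  case 0
  then show ?case by (simp add: ec_add_inf_right)
next
  case (Suc i)
  from ec_double_rational_x[OF assms(1) Suc.prems] obtain y' where
    y': "ec_add (base_change (E_curve u)) (Pt (of_rat (of_int u * t)) y) (Pt (of_rat (of_int u * t)) y) =
      Pt (of_rat (of_int u * double_x t)) y'"
    "on_curve (base_change (E_curve u)) (Pt (of_rat (of_int u * double_x t)) y')" "y \<noteq> 0" .
  have "ec_mult (base_change (E_curve u)) (2 ^ Suc i) (Pt (of_rat (of_int u * t)) y) =
    ec_mult (base_change (E_curve u)) (2 ^ i) (Pt (of_rat (of_int u * double_x t)) y')"
    using y'(1) unfolding base_change_E_curve power_Suc
      ec_mult_double[OF Suc.prems[unfolded base_change_E_curve] y'(3)]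
    by (simp only:)
  with Suc.IH[OF y'(2)] show ?case by (simp add: funpow_swap1)
qed

text \<open>
  The points \<open>2^i P\<close> for \<open>i > 0\<close> have \<open>x\<close>-coordinates \<open>u t_i\<close> with strictly falling 2-adic
  valuations of \<open>t_i\<close>, whereas a \<open>k\<close>-torsion point has at most \<open>k\<close> different multiples.
\<close>

lemma torsion_x_irrational:
  assumes "u \<noteq> 0" and "k > 0" and "on_curve (base_change (E_curve u)) P"
    and "ec_mult (base_change (E_curve u)) k P = PtInf"
  shows "x_proj P \<notin> Fin ` \<rat>"
proof
  assume "x_proj P \<in> Fin ` \<rat>"
  then obtain r y where "P = Pt (of_rat r) y"
    by (cases P) (auto simp: Rats_def)
  moreover have "r = of_int u * (r / of_int u)" using assms(1) by simp
  ultimately obtain t where P: "P = Pt (of_rat (of_int u * t)) y" by metis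
  obtain j where j: "j > 0" "two_pole j (double_x t)" using two_pole_double_x_start by blast
  have pole: "two_pole (j + 2 * i) ((double_x ^^ Suc i) t)" for i
  proof (induction i)
    case 0
    then show ?case using j by simp
  next
    case (Suc i)
    from two_pole_double_x[OF this] j show ?case by simp
  qed
  have "inj (\<lambda>i. ec_mult (base_change (E_curve u)) (2 ^ Suc i) P)"
  proof (rule injI)
    fix i i'
    assume "ec_mult (base_change (E_curve u)) (2 ^ Suc i) P =
      ec_mult (base_change (E_curve u)) (2 ^ Suc i') P"
    then have "(of_rat (of_int u * (double_x ^^ Suc i) t) :: complex)
        = of_rat (of_int u * (double_x ^^ Suc i') t)"
      using ec_mult_pow2_rational_x[OF assms(1), of t y] assms(3) unfolding P by (metis ec_point.inject)
    then have "(double_x ^^ Suc i) t = (double_x ^^ Suc i') t"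
      using assms(1) by (simp del: funpow.simps)
    then show "i = i'" using two_pole_unique pole[of i] pole[of i'] by fastforce
  qed
  moreover have "range (\<lambda>i. ec_mult (base_change (E_curve u)) (2 ^ Suc i) P)
      \<subseteq> (\<lambda>n. ec_mult (base_change (E_curve u)) n P) ` {..<k}"
  proof (rule image_subsetI)
    fix i
    have "ec_mult (base_change (E_curve u)) (2 ^ Suc i) P =
      ec_mult (base_change (E_curve u)) (2 ^ Suc i mod k) P"
      by (rule ec_mult_mod[OF assms(4)])
    moreover have "2 ^ Suc i mod k \<in> {..<k}" using assms(2) by simp
    ultimately show "ec_mult (base_change (E_curve u)) (2 ^ Suc i) P
        \<in> (\<lambda>n. ec_mult (base_change (E_curve u)) n P) ` {..<k}"
      by (rule image_eqI)
  qed
  ultimately show False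
    by (meson finite_imageD finite_imageI finite_lessThan finite_subset infinite_UNIV_nat)
qed

section \<open>Roots of the division polynomials modulo primes\<close>

text \<open>
  The norm of \<open>a + b \<theta> + c \<theta>^2\<close>, where \<open>\<theta>^3 = 3\<close>.
\<close>

definition cubic_norm :: "int \<Rightarrow> int \<Rightarrow> int \<Rightarrow> int" where
  "cubic_norm a b c = a ^ 3 + 3 * b ^ 3 + 9 * c ^ 3 - 9 * a * b * c"

lemma prime_dvd_cube_iff: "prime (p::int) \<Longrightarrow> p dvd a ^ 3 \<longleftrightarrow> p dvd a"
  by (rule prime_dvd_power_iff) auto

lemma cong_inverse_exists:
  assumes "prime p" and "\<not> p dvd (a::int)"
  obtains b where "[a * b = 1] (mod p)"
proof -
  have "coprime a p" using assms prime_imp_coprime coprime_commute by blast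
  then show ?thesis using cong_solve_coprime_int that by blast
qed

text \<open>
  The norm form is anisotropic on \<open>a + b \<theta>\<close>, since a nontrivial zero would make 3 a cube.
\<close>

lemma dvd_cube_plus_3_cube:
  assumes p: "prime p" and nc: "\<And>c::int. \<not> p dvd c ^ 3 - 3"
    and "p dvd a ^ 3 + 3 * b ^ 3"
  shows "p dvd a \<and> p dvd b"
proof (cases "p dvd b")
  case True
  then have "p dvd 3 * b ^ 3" by (simp add: prime_dvd_cube_iff[OF p])
  then have "p dvd a ^ 3" using assms(3) by (metis dvd_add_left_iff)
  then show ?thesis using True prime_dvd_cube_iff[OF p] by blast
next
  case False
  then obtain d where d: "[b * d = 1] (mod p)" using cong_inverse_exists[OF p] by blast
  have "p dvd d ^ 3 * (a ^ 3 + 3 * b ^ 3)" using assms(3) by simp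
  then have "[d ^ 3 * (a ^ 3 + 3 * b ^ 3) = 0] (mod p)" by (simp add: cong_0_iff)
  moreover have "d ^ 3 * (a ^ 3 + 3 * b ^ 3) = (a * d) ^ 3 + 3 * (b * d) ^ 3" by algebra
  moreover have "[(a * d) ^ 3 + 3 * (b * d) ^ 3 = (a * d) ^ 3 + 3 * 1 ^ 3] (mod p)"
    by (intro cong_add cong_mult cong_pow d cong_refl)
  ultimately have "[(a * d) ^ 3 + 3 = 0] (mod p)"
    by (metis cong_sym cong_trans mult.right_neutral power_one)
  then have "p dvd (a * d) ^ 3 + 3" by (simp add: cong_0_iff)
  then have "p dvd - ((a * d) ^ 3 + 3)" by (simp only: dvd_minus_iff)
  also have "- ((a * d) ^ 3 + 3) = (- (a * d)) ^ 3 - 3" by algebra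
  finally show ?thesis using nc by blast
qed

text \<open>
  Multiplication of \<open>a + b \<theta> + c \<theta>^2\<close> by \<open>b - c \<theta>\<close> leads to an element \<open>a' + b' \<theta>\<close>, to which the
  previous lemma applies.  So \<open>\<theta>\<close> generates a field over the integers modulo \<open>p\<close> if 3 is not a cube.
\<close>

lemma cubic_norm_anisotropic:
  assumes p: "prime p" and nc: "\<And>c::int. \<not> p dvd c ^ 3 - 3"
    and N: "p dvd cubic_norm a b c"
  shows "p dvd a \<and> p dvd b \<and> p dvd c"
proof -
  have c: "p dvd c"
  proof -
    have "(a * b - 3 * c ^ 2) ^ 3 + 3 * (b ^ 2 - a * c) ^ 3 =
      cubic_norm a b c * (b ^ 3 - 3 * c ^ 3)"
      unfolding cubic_norm_def by algebra
    then have "p dvd (a * b - 3 * c ^ 2) ^ 3 + 3 * (b ^ 2 - a * c) ^ 3"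
      using N by simp
    then have "p dvd a * b - 3 * c ^ 2" "p dvd b ^ 2 - a * c"
      using dvd_cube_plus_3_cube[OF p nc] by blast+
    then have "p dvd b * (b ^ 2 - a * c) + c * (a * b - 3 * c ^ 2)" by simp
    also have "b * (b ^ 2 - a * c) + c * (a * b - 3 * c ^ 2) = b ^ 3 + 3 * (- c) ^ 3" by algebra
    finally have "p dvd - c" using dvd_cube_plus_3_cube[OF p nc] by blast
    then show ?thesis by simp
  qed
  have "p dvd cubic_norm a b c - c * (9 * c ^ 2 - 9 * a * b)" using N c by simp
  also have "cubic_norm a b c - c * (9 * c ^ 2 - 9 * a * b) = a ^ 3 + 3 * b ^ 3"
    unfolding cubic_norm_def by algebra
  finally show ?thesis using dvd_cube_plus_3_cube[OF p nc] c by blast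
qed

text \<open>
  The triple \<open>(a, b, c)\<close> stands for \<open>a + b \<theta> + c \<theta>^2\<close>.  Modulo \<open>p\<close> these are the elements of the
  field with \<open>p^3\<close> elements if 3 is not a cube modulo \<open>p\<close>.
\<close>

type_synonym triple = "int \<times> int \<times> int"

fun tmul :: "triple \<Rightarrow> triple \<Rightarrow> triple" where
  "tmul (a, b, c) (d, e, f) = (a * d + 3 * (b * f + c * e), a * e + b * d + 3 * c * f, a * f + b * e + c * d)"

fun tnorm :: "triple \<Rightarrow> int" where
  "tnorm (a, b, c) = cubic_norm a b c"

fun tmod :: "int \<Rightarrow> triple \<Rightarrow> triple" where
  "tmod p (a, b, c) = (a mod p, b mod p, c mod p)"

fun tdiff :: "triple \<Rightarrow> triple \<Rightarrow> triple" where
  "tdiff (a, b, c) (d, e, f) = (a - d, b - e, c - f)"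

fun tadd :: "triple \<Rightarrow> triple \<Rightarrow> triple" where
  "tadd (a, b, c) (d, e, f) = (a + d, b + e, c + f)"

lemma tnorm_tmul: "tnorm (tmul x y) = tnorm x * tnorm y"
proof -
  obtain a b c where x: "x = (a, b, c)" by (cases x) auto
  obtain d e f where y: "y = (d, e, f)" by (cases y) auto
  show ?thesis unfolding x y tmul.simps tnorm.simps cubic_norm_def by algebra
qed

lemma tmod_eq_iff: "tmod p x = tmod p y \<longleftrightarrow> tmod p (tdiff x y) = (0, 0, 0)"
  by (cases x; cases y) (auto simp: mod_eq_dvd_iff)

lemma mod_self_cong: "[a mod p = a] (mod p)" for a p :: int
  by (simp add: cong_def)

lemma tnorm_tmod: "[tnorm (tmod p x) = tnorm x] (mod p)"
proof -
  obtain a b c where x: "x = (a, b, c)" by (cases x) auto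
  show ?thesis unfolding x tmod.simps tnorm.simps cubic_norm_def
    by (intro cong_add cong_diff cong_mult cong_pow cong_refl mod_self_cong)
qed

lemma tmod_zero_iff:
  assumes "prime p" and "\<And>c::int. \<not> p dvd c ^ 3 - 3"
  shows "tmod p x = (0, 0, 0) \<longleftrightarrow> p dvd tnorm x"
proof -
  obtain a b c where x: "x = (a, b, c)" by (cases x) auto
  show ?thesis
  proof
    assume "tmod p x = (0, 0, 0)"
    then have "[tnorm x = tnorm (0, 0, 0)] (mod p)"
      using tnorm_tmod[of p x] by (simp add: cong_sym)
    then show "p dvd tnorm x" by (simp add: cong_0_iff cubic_norm_def)
  next
    assume "p dvd tnorm x"
    then have "p dvd a \<and> p dvd b \<and> p dvd c"
      unfolding x tnorm.simps by (rule cubic_norm_anisotropic[OF assms])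
    then show "tmod p x = (0, 0, 0)" by (simp add: x mod_eq_0_iff_dvd)
  qed
qed

lemma tmul_tdiff: "tdiff (tmul x y) (tmul x z) = tmul x (tdiff y z)"
  by (cases x; cases y; cases z) (simp add: algebra_simps)

lemma tmul_square_diff: "tdiff (tmul x x) (tmul y y) = tmul (tdiff x y) (tadd x y)"
  by (cases x; cases y) (simp add: algebra_simps)

definition residue_triples :: "int \<Rightarrow> triple set" where
  "residue_triples p = {0..<p} \<times> {0..<p} \<times> {0..<p}"

lemma tmod_in_residue_triples: "p > 0 \<Longrightarrow> tmod p x \<in> residue_triples p"
  by (cases x) (simp add: residue_triples_def)

lemma tmod_residue_triples: "x \<in> residue_triples p \<Longrightarrow> tmod p x = x"
  by (auto simp: residue_triples_def)

lemma finite_residue_triples: "finite (residue_triples p)"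
  by (simp add: residue_triples_def)

lemma card_residue_triples: "p > 0 \<Longrightarrow> card (residue_triples p) = nat p ^ 3"
  by (simp add: residue_triples_def card_cartesian_product power3_eq_cube)

definition nonzero_squares :: "int \<Rightarrow> triple set" where
  "nonzero_squares p = (\<lambda>s. tmod p (tmul s s)) ` (residue_triples p - {(0, 0, 0)})"

lemma exists_nonresidue:
  assumes "p > (2::int)"
  obtains n where "\<And>x. \<not> [x ^ 2 = n] (mod p)"
proof -
  define g where "g x = x ^ 2 mod p" for x
  have "g ` {0..<p} \<noteq> {0..<p}"
  proof
    assume "g ` {0..<p} = {0..<p}"
    then have "inj_on g {0..<p}" by (intro eq_card_imp_inj_on) auto
    moreover have "g (p - 1) = g 1"
    proof -
      have "(p - 1) ^ 2 = 1 + p * (p - 2)" by algebra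
      then show ?thesis unfolding g_def by simp
    qed
    ultimately have "p - 1 = 1" using assms by (auto dest: inj_onD)
    then show False using assms by simp
  qed
  moreover have "g ` {0..<p} \<subseteq> {0..<p}" using assms by (auto simp: g_def)
  ultimately obtain n where n: "n \<in> {0..<p}" "n \<notin> g ` {0..<p}" by blast
  show ?thesis
  proof
    fix x
    show "\<not> [x ^ 2 = n] (mod p)"
    proof
      assume "[x ^ 2 = n] (mod p)"
      then have "g (x mod p) = n" using n by (simp add: g_def cong_def power_mod)
      moreover have "x mod p \<in> {0..<p}" using assms by simp
      ultimately show False using n by blast
    qed
  qed
qed

context
  fixes p :: int
  assumes p: "prime p" and p2: "p > 2" and nc: "\<And>c::int. \<not> p dvd c ^ 3 - 3"
begin

lemma tmod_zero: "tmod p x = (0, 0, 0) \<longleftrightarrow> p dvd tnorm x"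
  by (rule tmod_zero_iff[OF p nc])

lemma tmul_cancel:
  assumes "\<not> p dvd tnorm x" and "tmod p (tmul x y) = tmod p (tmul x z)"
  shows "tmod p y = tmod p z"
  using assms by (simp add: tmod_eq_iff tmul_tdiff tmod_zero tnorm_tmul prime_dvd_mult_iff[OF p])

lemma tnorm_residue_triples: "s \<in> residue_triples p - {(0, 0, 0)} \<Longrightarrow> \<not> p dvd tnorm s"
  by (metis Diff_iff singletonI tmod_residue_triples tmod_zero)

lemma tnorm_nonzero_squares: "q \<in> nonzero_squares p \<Longrightarrow> \<exists>m. \<not> p dvd m \<and> [tnorm q = m ^ 2] (mod p)"
proof -
  assume "q \<in> nonzero_squares p"
  then obtain s where s: "s \<in> residue_triples p - {(0, 0, 0)}" "q = tmod p (tmul s s)"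
    unfolding nonzero_squares_def by blast
  have "[tnorm q = tnorm s ^ 2] (mod p)"
    using tnorm_tmod[of p "tmul s s"] by (simp add: s(2) tnorm_tmul power2_eq_square)
  then show ?thesis using tnorm_residue_triples[OF s(1)] by blast
qed

lemma finite_nonzero_squares: "finite (nonzero_squares p)"
  by (simp add: nonzero_squares_def finite_residue_triples)

lemma nonzero_squares_subset: "nonzero_squares p \<subseteq> residue_triples p - {(0, 0, 0)}"
proof
  fix q assume q: "q \<in> nonzero_squares p"
  then have "q \<in> residue_triples p" using tmod_in_residue_triples p2 unfolding nonzero_squares_def by force
  moreover have "\<not> p dvd tnorm q"
    using tnorm_nonzero_squares[OF q] p by (metis cong_dvd_iff prime_dvd_power)
  ultimately show "q \<in> residue_triples p - {(0, 0, 0)}" using tmod_zero tmod_residue_triples by fastforce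
qed

text \<open>
  An element of a field has at most two square roots.
\<close>

lemma card_nonzero_squares: "nat p ^ 3 \<le> 1 + 2 * card (nonzero_squares p)"
proof -
  have "\<forall>q \<in> nonzero_squares p. \<exists>s. s \<in> residue_triples p \<and> tmod p (tmul s s) = q"
    unfolding nonzero_squares_def by blast
  then obtain r where r: "\<And>q. q \<in> nonzero_squares p \<Longrightarrow> r q \<in> residue_triples p \<and> tmod p (tmul (r q) (r q)) = q"
    by metis
  define r' where "r' q = tmod p (tdiff (0, 0, 0) (r q))" for q
  have "residue_triples p \<subseteq> insert (0, 0, 0) (r ` nonzero_squares p \<union> r' ` nonzero_squares p)"
  proof
    fix s assume s: "s \<in> residue_triples p"
    show "s \<in> insert (0, 0, 0) (r ` nonzero_squares p \<union> r' ` nonzero_squares p)"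
    proof (cases "s = (0, 0, 0)")
      case False
      define q where "q = tmod p (tmul s s)"
      have q: "q \<in> nonzero_squares p" using s False unfolding q_def nonzero_squares_def by blast
      have "tmod p (tmul s s) = tmod p (tmul (r q) (r q))" using r[OF q] q_def by simp
      then have "p dvd tnorm (tdiff s (r q)) * tnorm (tadd s (r q))"
        by (simp add: tmod_eq_iff tmul_square_diff tmod_zero tnorm_tmul)
      then consider "p dvd tnorm (tdiff s (r q))" | "p dvd tnorm (tadd s (r q))"
        using p by (auto simp: prime_dvd_mult_iff)
      then show ?thesis
      proof cases
        case 1
        then have "tmod p s = tmod p (r q)" by (simp add: tmod_eq_iff tmod_zero)
        then have "s = r q" using s r[OF q] tmod_residue_triples by metis
        then show ?thesis using q by blast
      next
        case 2
        have "tdiff s (tdiff (0, 0, 0) (r q)) = tadd s (r q)"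
          by (cases s; cases "r q") simp
        then have "tmod p s = tmod p (tdiff (0, 0, 0) (r q))"
          using 2 by (simp add: tmod_eq_iff tmod_zero)
        then have "s = r' q" using s tmod_residue_triples by (metis r'_def)
        then show ?thesis using q by blast
      qed
    qed simp
  qed
  then have "card (residue_triples p) \<le> card (insert (0, 0, 0) (r ` nonzero_squares p \<union> r' ` nonzero_squares p))"
    by (intro card_mono) (auto simp: finite_nonzero_squares)
  also have "\<dots> \<le> Suc (card (r ` nonzero_squares p \<union> r' ` nonzero_squares p))"
    by (rule card_insert_le_m1) auto
  also have "\<dots> \<le> Suc (card (r ` nonzero_squares p) + card (r' ` nonzero_squares p))"
    by (simp add: card_Un_le)
  also have "\<dots> \<le> Suc (card (nonzero_squares p) + card (nonzero_squares p))"
    using card_image_le[OF finite_nonzero_squares] by (intro Suc_le_mono[THEN iffD2] add_mono) auto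
  finally show ?thesis using card_residue_triples p2 by simp
qed

lemma card_tmul_nonzero_squares:
  assumes "\<not> p dvd tnorm e"
  shows "card ((\<lambda>q. tmod p (tmul e q)) ` nonzero_squares p) = card (nonzero_squares p)"
proof (intro card_image inj_onI)
  fix x y assume "x \<in> nonzero_squares p" "y \<in> nonzero_squares p" "tmod p (tmul e x) = tmod p (tmul e y)"
  then show "x = y" using tmul_cancel[OF assms] nonzero_squares_subset tmod_residue_triples by (metis Diff_iff subsetD)
qed

lemma tmul_nonzero_squares_subset:
  assumes "\<not> p dvd tnorm e"
  shows "(\<lambda>q. tmod p (tmul e q)) ` nonzero_squares p \<subseteq> residue_triples p - {(0, 0, 0)}"
proof (rule image_subsetI)
  fix q assume q: "q \<in> nonzero_squares p"
  have "\<not> p dvd tnorm (tmul e q)"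
    using assms tnorm_residue_triples subsetD[OF nonzero_squares_subset q] by (simp add: tnorm_tmul prime_dvd_mult_iff[OF p])
  then show "tmod p (tmul e q) \<in> residue_triples p - {(0, 0, 0)}"
    using tmod_zero tmod_in_residue_triples p2 by simp
qed

text \<open>
  Taking norms of an equation \<open>e s^2 = n t^2\<close> with \<open>n\<close> a nonresidue modulo \<open>p\<close> yields
  \<open>(m N(s))^2 = n^3 N(t)^2\<close> and so a square root of \<open>n\<close> modulo \<open>p\<close>.
\<close>

lemma tmul_square_classes_disjoint:
  assumes n: "\<And>x. \<not> [x ^ 2 = n] (mod p)" and e: "[tnorm e = m ^ 2] (mod p)"
  shows "(\<lambda>q. tmod p (tmul e q)) ` nonzero_squares p \<inter>
    (\<lambda>q. tmod p (tmul (n, 0, 0) q)) ` nonzero_squares p = {}"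
proof (rule ccontr)
  assume "\<not> ?thesis"
  then obtain x where x: "x \<in> (\<lambda>q. tmod p (tmul e q)) ` nonzero_squares p"
    "x \<in> (\<lambda>q. tmod p (tmul (n, 0, 0) q)) ` nonzero_squares p" by blast
  obtain q where q1: "x = tmod p (tmul e q)" "q \<in> nonzero_squares p" using x(1) by (rule imageE)
  obtain q' where q2: "x = tmod p (tmul (n, 0, 0) q')" "q' \<in> nonzero_squares p" using x(2) by (rule imageE)
  have q: "q \<in> nonzero_squares p" "q' \<in> nonzero_squares p"
    "tmod p (tmul e q) = tmod p (tmul (n, 0, 0) q')" using q1 q2 by (blast, blast, metis)
  obtain k k' where k: "[tnorm q = k ^ 2] (mod p)"
      "\<not> p dvd k'" "[tnorm q' = k' ^ 2] (mod p)"
    using tnorm_nonzero_squares q by meson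
  have "\<not> p dvd n" using n[of 0] by (auto simp: cong_def mod_eq_0_iff_dvd)
  then have "\<not> p dvd n * k'" using k(2) by (simp add: prime_dvd_mult_iff[OF p])
  then obtain w where w: "[n * k' * w = 1] (mod p)" using cong_inverse_exists[OF p] by blast
  have "[m ^ 2 * k ^ 2 = tnorm (tmul e q)] (mod p)"
    unfolding tnorm_tmul using e k(1) by (intro cong_mult) (auto simp: cong_sym)
  also have "[tnorm (tmul e q) = tnorm (tmul (n, 0, 0) q')] (mod p)"
    using tnorm_tmod[of p "tmul e q"] tnorm_tmod[of p "tmul (n, 0, 0) q'"] q(3)
    by (metis cong_sym cong_trans)
  also have "[tnorm (tmul (n, 0, 0) q') = n ^ 3 * k' ^ 2] (mod p)"
    unfolding tnorm_tmul by (intro cong_mult k) (simp add: cubic_norm_def)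
  finally have "[m ^ 2 * k ^ 2 * w ^ 2 = n ^ 3 * k' ^ 2 * w ^ 2] (mod p)"
    by (rule cong_mult[OF _ cong_refl])
  also have "n ^ 3 * k' ^ 2 * w ^ 2 = n * (n * k' * w) ^ 2" by algebra
  also have "[n * (n * k' * w) ^ 2 = n * 1 ^ 2] (mod p)" by (intro cong_mult cong_pow w cong_refl)
  finally have "[(m * k * w) ^ 2 = n] (mod p)" by (simp add: power_mult_distrib)
  then show False using n by blast
qed

text \<open>
  For an element \<open>e\<close> whose norm is a nonzero square, the class \<open>e S\<close> of the set \<open>S\<close> of nonzero squares
  is disjoint from \<open>n S\<close>.  Both contain at least half of the nonzero elements, so \<open>e S\<close> is the
  complement of \<open>n S\<close>, whichever \<open>e\<close> is taken.  The choices \<open>e = 1\<close> and \<open>e = d\<close> give \<open>S = d S\<close>,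
  and \<open>d\<close> is a square.
\<close>

lemma square_of_square_norm:
  assumes m: "\<not> p dvd m" and d: "[tnorm d = m ^ 2] (mod p)"
  shows "\<exists>s. tmod p (tmul s s) = tmod p d"
proof -
  obtain n where n: "\<And>x. \<not> [x ^ 2 = n] (mod p)" using exists_nonresidue[OF p2] by blast
  define C where "C e = (\<lambda>q. tmod p (tmul e q)) ` nonzero_squares p" for e
  define T where "T = residue_triples p - {(0, 0, 0)}"
  have finT: "finite T" by (simp add: T_def finite_residue_triples)
  have n0: "\<not> p dvd n" using n[of 0] by (auto simp: cong_def mod_eq_0_iff_dvd)
  have nn: "\<not> p dvd tnorm (n, 0, 0)" using n0 by (simp add: cubic_norm_def prime_dvd_cube_iff[OF p])
  have "(0, 0, 0) \<in> residue_triples p" using p2 by (simp add: residue_triples_def)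
  then have "card T = nat p ^ 3 - 1" using p2 by (simp add: T_def card_residue_triples finite_residue_triples)
  then have cT: "card T \<le> 2 * card (nonzero_squares p)" using card_nonzero_squares by linarith
  have full: "C e = T - C (n, 0, 0)" if "\<not> p dvd k" "[tnorm e = k ^ 2] (mod p)" for e k
  proof (rule card_seteq)
    have e: "\<not> p dvd tnorm e" using that p by (metis cong_dvd_iff prime_dvd_power)
    show "C e \<subseteq> T - C (n, 0, 0)"
      using tmul_nonzero_squares_subset[OF e] tmul_square_classes_disjoint[OF n that(2)]
      unfolding C_def T_def by blast
    have "card (T - C (n, 0, 0)) = card T - card (C (n, 0, 0))"
      using tmul_nonzero_squares_subset[OF nn] finT finite_nonzero_squares
      unfolding C_def T_def by (intro card_Diff_subset) auto
    also have "\<dots> = card T - card (nonzero_squares p)"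
      using card_tmul_nonzero_squares[OF nn] by (simp add: C_def)
    also have "\<dots> \<le> card (nonzero_squares p)" using cT by simp
    also have "\<dots> = card (C e)" using card_tmul_nonzero_squares[OF e] by (simp add: C_def)
    finally show "card (T - C (n, 0, 0)) \<le> card (C e)" .
  qed (use finT in auto)
  have one: "tmod p (1, 0, 0) \<in> nonzero_squares p"
    unfolding nonzero_squares_def
    by (rule image_eqI[of _ _ "(1, 0, 0)"]) (use p2 in \<open>simp_all add: residue_triples_def\<close>)
  have "\<not> p dvd 1" using p by auto
  then have "C (1, 0, 0) = C d"
    using full[of 1 "(1, 0, 0)"] full[OF m d] by (simp add: cubic_norm_def)
  moreover have "tmod p (tmul d (tmod p (1, 0, 0))) \<in> C d"
    unfolding C_def using one by blast
  moreover have "tmod p (tmul d (tmod p (1, 0, 0))) = tmod p d"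
    using p2 by (cases d) simp
  ultimately obtain q where q: "q \<in> nonzero_squares p" "tmod p d = tmod p (tmul (1, 0, 0) q)"
    unfolding C_def by (metis (no_types, lifting) imageE)
  have "tmul (1, 0, 0) q = q" by (cases q) simp
  with q have "tmod p d = q" using tmod_residue_triples nonzero_squares_subset by (metis Diff_iff subsetD)
  with q(1) show ?thesis unfolding nonzero_squares_def by (metis (no_types, lifting) imageE)
qed

end

text \<open>
  Let \<open>s = a + b \<theta> + c \<theta>^2\<close> be a square root of \<open>3 + \<theta>^2\<close>, with norm \<open>N = \<plusminus>6\<close>.  Its conjugates have the
  sum \<open>3 a\<close>.  The sum of their squares is \<open>9\<close> and the second elementary symmetric function of the
  squares is \<open>27\<close>, so \<open>x = 3 a\<close> satisfies \<open>((x^2 - 9) / 2)^2 = 27 + 2 N x\<close>, that is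
  \<open>x^4 - 18 x^2 - 8 N x - 27 = 0\<close>.  For \<open>N = - 6\<close> this is the quartic; for \<open>N = 6\<close> take \<open>- s\<close>.
\<close>

lemma cubic_or_quartic_root:
  assumes p: "prime p" and p3: "p > (3::int)"
  shows "\<exists>x. p dvd x ^ 3 - 9 * x + 12 \<or> p dvd x ^ 4 - 18 * x ^ 2 + 48 * x - 27"
proof (cases "\<exists>c. p dvd c ^ 3 - 3")
  case True
  then obtain c where c: "p dvd c ^ 3 - 3" by blast
  have "(- (c + c ^ 2)) ^ 3 - 9 * (- (c + c ^ 2)) + 12 = (c ^ 3 - 3) * (- ((1 + c) ^ 3) - 3)"
    by algebra
  then show ?thesis using c by (metis dvd_mult2)
next
  case False
  have p2: "p > 2" using p3 by simp
  have "\<not> p dvd 6"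
  proof
    assume "p dvd 6"
    then have "p dvd 2 * 3" by simp
    then have "p dvd 2 \<or> p dvd 3" using p prime_dvd_mult_iff by blast
    then show False using p3 zdvd_not_zless[of 2 p] zdvd_not_zless[of 3 p] by auto
  qed
  moreover have "[tnorm (3, 0, 1) = 6 ^ 2] (mod p)" by (simp add: cubic_norm_def)
  \<comment> \<open>The triple \<open>(3, 0, 1)\<close> is \<open>3 + \<theta>^2\<close>, of norm \<open>27 + 9 = 36\<close>.\<close>
  ultimately obtain s where s: "tmod p (tmul s s) = tmod p (3, 0, 1)"
    using square_of_square_norm[OF p p2] False by blast
  obtain a b c where abc: "s = (a, b, c)" by (cases s) auto
  \<comment> \<open>\<open>P + Q \<theta> + R \<theta>^2\<close> is the square of \<open>s\<close>; \<open>N\<close> is the norm of \<open>s\<close>.\<close>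
  define P Q R N where "P = a ^ 2 + 6 * b * c" and "Q = 2 * a * b + 3 * c ^ 2"
    and "R = b ^ 2 + 2 * a * c" and "N = cubic_norm a b c"
  have ss: "tmul s s = (P, Q, R)"
    by (simp add: abc P_def Q_def R_def power2_eq_square algebra_simps)
  have P: "p dvd P - 3" and Q: "p dvd Q" using s unfolding ss
    by (simp_all add: mod_eq_dvd_iff mod_eq_0_iff_dvd)
  have "[tnorm (tmul s s) = tnorm (3, 0, 1)] (mod p)"
    using s tnorm_tmod[of p "tmul s s"] tnorm_tmod[of p "(3, 0, 1)"] by (metis cong_sym cong_trans)
  then have "p dvd N * N - 36"
    unfolding tnorm_tmul by (simp add: abc N_def cong_iff_dvd_diff cubic_norm_def[of 3 0 1])
  also have "N * N - 36 = (N + 6) * (N - 6)" by algebra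
  finally consider "p dvd N + 6" | "p dvd N - 6" using p by (auto simp: prime_dvd_mult_iff)
  then show ?thesis
  proof cases
    case 1
    have "(3 * a) ^ 4 - 18 * (3 * a) ^ 2 + 48 * (3 * a) - 27 =
        54 * a ^ 2 * (P - 3) + 24 * a * (N + 6) + 3 * (P + 3) * (P - 3) - 36 * R * Q"
      unfolding P_def Q_def R_def N_def cubic_norm_def by algebra
    also have "p dvd \<dots>" by (intro dvd_add dvd_diff dvd_mult P Q 1)
    finally show ?thesis by blast
  next
    case 2
    have "(- 3 * a) ^ 4 - 18 * (- 3 * a) ^ 2 + 48 * (- 3 * a) - 27 =
        54 * a ^ 2 * (P - 3) + 24 * a * (N - 6) + 3 * (P + 3) * (P - 3) - 36 * R * Q"
      unfolding P_def Q_def R_def N_def cubic_norm_def by algebra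
    also have "p dvd \<dots>" by (intro dvd_add dvd_diff dvd_mult P Q 2)
    finally show ?thesis by blast
  qed
qed

section \<open>Counting points modulo a prime\<close>

lemma even_card_involution:
  assumes "finite S" and "\<And>x. x \<in> S \<Longrightarrow> g x \<in> S \<and> g (g x) = x \<and> g x \<noteq> x"
  shows "even (card S)"
proof -
  have "2 dvd card (\<Union>((\<lambda>x. {x, g x}) ` S))"
  proof (rule dvd_partition)
    show "finite (\<Union>((\<lambda>x. {x, g x}) ` S))" using assms(1) by blast
    show "\<forall>c\<in>(\<lambda>x. {x, g x}) ` S. 2 dvd card c"
    proof
      fix c assume "c \<in> (\<lambda>x. {x, g x}) ` S"
      then obtain x where x: "x \<in> S" "c = {x, g x}" by blast
      have "g x \<noteq> x" using assms(2) x(1) by metis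
      then show "2 dvd card c" unfolding x(2) by simp
    qed
    show "\<forall>c1\<in>(\<lambda>x. {x, g x}) ` S. \<forall>c2\<in>(\<lambda>x. {x, g x}) ` S. c1 \<noteq> c2 \<longrightarrow> c1 \<inter> c2 = {}"
    proof (intro ballI impI)
      fix c1 c2 assume "c1 \<in> (\<lambda>x. {x, g x}) ` S" "c2 \<in> (\<lambda>x. {x, g x}) ` S" and ne: "c1 \<noteq> c2"
      then obtain x y where xy: "x \<in> S" "y \<in> S" "c1 = {x, g x}" "c2 = {y, g y}" by blast
      show "c1 \<inter> c2 = {}"
      proof (rule ccontr)
        assume "c1 \<inter> c2 \<noteq> {}"
        then have "x = y \<or> x = g y \<or> g x = y \<or> g x = g y" unfolding xy by blast
        then have "c1 = c2" unfolding xy using assms(2) xy(1,2) by (metis insert_commute)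
        then show False using ne by contradiction
      qed
    qed
  qed
  moreover have "\<Union>((\<lambda>x. {x, g x}) ` S) = S" using assms(2) by blast
  ultimately show ?thesis by simp
qed

lemma three_dvd_card_cycle:
  assumes "finite S" and "\<And>x. x \<in> S \<Longrightarrow> g x \<in> S \<and> g (g (g x)) = x \<and> g x \<noteq> x"
  shows "3 dvd card S"
proof -
  have "3 dvd card (\<Union>((\<lambda>x. {x, g x, g (g x)}) ` S))"
  proof (rule dvd_partition)
    show "finite (\<Union>((\<lambda>x. {x, g x, g (g x)}) ` S))" using assms(1) by blast
    show "\<forall>c\<in>(\<lambda>x. {x, g x, g (g x)}) ` S. 3 dvd card c"
    proof
      fix c assume "c \<in> (\<lambda>x. {x, g x, g (g x)}) ` S"
      then obtain x where x: "x \<in> S" "c = {x, g x, g (g x)}" by blast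
      have "g x \<noteq> x" "g (g x) \<noteq> g x" "g (g x) \<noteq> x" using assms(2) x(1) by metis+
      then have "card c = 3" unfolding x(2) by simp
      then show "3 dvd card c" by simp
    qed
    show "\<forall>c1\<in>(\<lambda>x. {x, g x, g (g x)}) ` S. \<forall>c2\<in>(\<lambda>x. {x, g x, g (g x)}) ` S.
        c1 \<noteq> c2 \<longrightarrow> c1 \<inter> c2 = {}"
    proof (intro ballI impI)
      fix c1 c2 assume "c1 \<in> (\<lambda>x. {x, g x, g (g x)}) ` S" "c2 \<in> (\<lambda>x. {x, g x, g (g x)}) ` S"
        and ne: "c1 \<noteq> c2"
      then obtain x y where xy: "x \<in> S" "y \<in> S" "c1 = {x, g x, g (g x)}" "c2 = {y, g y, g (g y)}"
        by blast
      have orbit: "{z, g z, g (g z)} = {w, g w, g (g w)}"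
        if "w \<in> S" "z \<in> {w, g w, g (g w)}" for z w
        using that assms(2) by auto
      show "c1 \<inter> c2 = {}"
      proof (rule ccontr)
        assume "c1 \<inter> c2 \<noteq> {}"
        then obtain z where "z \<in> c1" "z \<in> c2" by blast
        then have "c1 = c2" using orbit xy by metis
        then show False using ne by contradiction
      qed
    qed
  qed
  moreover have "\<Union>((\<lambda>x. {x, g x, g (g x)}) ` S) = S" using assms(2) by blast
  ultimately show ?thesis by simp
qed

lemma dvd_residue_eq:
  fixes p :: int
  assumes "x \<in> {0..<p}" and "y \<in> {0..<p}" and "p dvd x - y"
  shows "x = y"
proof -
  have "x mod p = y mod p" using assms(3) by (simp add: mod_eq_dvd_iff)
  then show ?thesis using assms(1,2) by simp
qed

lemma dvd_mod_self: "p dvd x mod p - x" for p :: int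
  by (metis dvd_minus_mod minus_diff_eq dvd_minus_iff)

text \<open>
  The affine points modulo \<open>p\<close> on the quadratic twist \<open>D y^2 = x^3 - 9 x + 12\<close>.
\<close>

definition twist_points :: "int \<Rightarrow> int \<Rightarrow> (int \<times> int) set" where
  "twist_points p D = {(x, y). x \<in> {0..<p} \<and> y \<in> {0..<p} \<and> p dvd D * y ^ 2 - (x ^ 3 - 9 * x + 12)}"

lemma finite_twist_points: "finite (twist_points p D)"
  by (rule finite_subset[of _ "{0..<p} \<times> {0..<p}"]) (auto simp: twist_points_def)

context
  fixes p :: int
  assumes p: "prime p" and p3: "p > 3"
begin

lemma p_pos: "p > 0"
  using p3 by simp

lemma inverse_mod: "\<not> p dvd a \<Longrightarrow> \<exists>b. p dvd a * b - 1"
  using p cong_solve_coprime_int[of a p] prime_imp_coprime[of p a]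
  by (auto simp: cong_iff_dvd_diff coprime_commute)

lemma not_dvd_2: "\<not> p dvd 2" and not_dvd_3: "\<not> p dvd 3"
  using p3 zdvd_not_zless[of 2 p] zdvd_not_zless[of 3 p] by auto

lemma not_dvd_1: "\<not> p dvd 1"
  using p by auto

lemma cancel_2: "p dvd 2 * a \<longleftrightarrow> p dvd a"
  using p not_dvd_2 by (simp only: prime_dvd_mult_iff) simp

lemma cancel_3: "p dvd 3 * a \<longleftrightarrow> p dvd a"
  using p not_dvd_3 by (simp only: prime_dvd_mult_iff) simp

text \<open>
  The roots other than \<open>r\<close> are the roots of \<open>x^2 + r x + r^2 - 9\<close>.  They are paired by
  \<open>x \<mapsto> - r - x\<close>, without fixed points because the cubic has no double root modulo \<open>p > 3\<close>.
\<close>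

lemma odd_card_cubic_roots:
  assumes r: "p dvd r ^ 3 - 9 * r + 12"
  shows "odd (card {x \<in> {0..<p}. p dvd x ^ 3 - 9 * x + 12})"
proof -
  define S where "S = {x \<in> {0..<p}. p dvd x ^ 3 - 9 * x + 12}"
  define r' where "r' = r mod p"
  have rr: "p dvd r' - r" unfolding r'_def by (rule dvd_mod_self)
  have f: "p dvd r' ^ 3 - 9 * r' + 12" using rr r by algebra
  then have rS: "r' \<in> S" using p_pos by (simp add: S_def r'_def)
  define g where "g x = (- r' - x) mod p" for x
  have g: "p dvd g x - (- r' - x)" for x unfolding g_def by (rule dvd_mod_self)
  have gr: "g x \<in> {0..<p}" for x using p_pos by (simp add: g_def)
  have "even (card (S - {r'}))"
  proof (rule even_card_involution[where g = g])
    show "finite (S - {r'})" by (rule finite_subset[of _ "{0..<p}"]) (auto simp: S_def)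
    fix x assume x: "x \<in> S - {r'}"
    then have x0: "x \<in> {0..<p}" and fx: "p dvd x ^ 3 - 9 * x + 12" by (simp_all add: S_def)
    have "\<not> p dvd x - r'" using x rS dvd_residue_eq[of x p r'] by (auto simp: S_def)
    moreover have "p dvd (x - r') * (x ^ 2 + r' * x + r' ^ 2 - 9)" using fx f by algebra
    ultimately have q: "p dvd x ^ 2 + r' * x + r' ^ 2 - 9" using p by (auto simp: prime_dvd_mult_iff)
    have "p dvd g x ^ 3 - 9 * g x + 12" using g[of x] q f by algebra
    then have gS: "g x \<in> S" using gr by (simp add: S_def)
    have gr': "g x \<noteq> r'"
    proof
      assume "g x = r'"
      then have "p dvd r' - (- r' - x)" using g[of x] by simp
      then have x2: "p dvd x + 2 * r'" by algebra
      then have "p dvd 3 * (r' ^ 2 - 3)" using q by algebra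
      then have r3: "p dvd r' ^ 2 - 3" by (simp only: cancel_3)
      then have "p dvd 2 * (3 * (r' - 2))" using f by algebra
      then have "p dvd r' - 2" by (simp only: cancel_2 cancel_3)
      then have "p dvd 1" using r3 by algebra
      then show False using not_dvd_1 by contradiction
    qed
    have gg: "g (g x) = x"
    proof (rule dvd_residue_eq[OF gr x0])
      show "p dvd g (g x) - x" using g[of x] g[of "g x"] by algebra
    qed
    have gx: "g x \<noteq> x"
    proof
      assume "g x = x"
      then have "p dvd x - (- r' - x)" using g[of x] by simp
      then have x2: "p dvd 2 * x + r'" by algebra
      have "3 * (r' ^ 2 - 12) = 4 * (x ^ 2 + r' * x + r' ^ 2 - 9) - (2 * x + r') * (2 * x + r')"
        by algebra
      also have "p dvd \<dots>" by (rule dvd_diff[OF dvd_mult[OF q] dvd_mult[OF x2]])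
      finally have "p dvd 3 * (r' ^ 2 - 12)" .
      then have r3: "p dvd r' ^ 2 - 12" by (simp only: cancel_3)
      have "3 * (r' + 4) = (r' ^ 3 - 9 * r' + 12) - r' * (r' ^ 2 - 12)" by algebra
      also have "p dvd \<dots>" by (rule dvd_diff[OF f dvd_mult[OF r3]])
      finally have "p dvd 3 * (r' + 4)" .
      then have "p dvd r' + 4" by (simp only: cancel_3)
      then have "p dvd 2 * (2 * 1)" using r3 by algebra
      then show False using not_dvd_1 by (simp only: cancel_2)
    qed
    show "g x \<in> S - {r'} \<and> g (g x) = x \<and> g x \<noteq> x" using gS gr' gg gx by blast
  qed
  moreover have "card S = Suc (card (S - {r'}))"
    using rS by (intro card.remove finite_subset[of S "{0..<p}"]) (auto simp: S_def)
  ultimately show ?thesis by (simp add: S_def)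
qed

text \<open>
  Points off the \<open>x\<close>-axis come in pairs \<open>(x, y)\<close>, \<open>(x, - y)\<close>.
\<close>

lemma odd_card_twist_points:
  assumes r: "p dvd r ^ 3 - 9 * r + 12"
  shows "odd (card (twist_points p D))"
proof -
  define Z where "Z = {x \<in> {0..<p}. p dvd x ^ 3 - 9 * x + 12}"
  define C where "C = twist_points p D"
  have "even (card {z \<in> C. snd z \<noteq> 0})"
  proof (rule even_card_involution[where g = "\<lambda>(x, y). (x, (- y) mod p)"])
    show "finite {z \<in> C. snd z \<noteq> 0}" by (simp add: C_def finite_twist_points)
    fix z assume z: "z \<in> {z \<in> C. snd z \<noteq> 0}"
    obtain x y where xy: "z = (x, y)" by (cases z)
    have x: "x \<in> {0..<p}" and y: "y \<in> {0..<p}" "y \<noteq> 0"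
      and e: "p dvd D * y ^ 2 - (x ^ 3 - 9 * x + 12)"
      using z by (simp_all add: xy C_def twist_points_def)
    have m: "(- y) mod p = p - y" using y by (simp add: zmod_zminus1_eq_if)
    have e': "p dvd D * (p - y) ^ 2 - (x ^ 3 - 9 * x + 12)" using e by algebra
    have "p - y \<noteq> y"
    proof
      assume "p - y = y"
      then have "2 * y = p" by simp
      then have "p dvd 2 * y" by simp
      then have "p dvd y" by (simp only: cancel_2)
      then show False using y zdvd_not_zless[of y p] by simp
    qed
    moreover have "(- (p - y)) mod p = y" using y by simp
    ultimately show "(case z of (x, y) \<Rightarrow> (x, (- y) mod p)) \<in> {z \<in> C. snd z \<noteq> 0} \<and>
        (case (case z of (x, y) \<Rightarrow> (x, (- y) mod p)) of (x, y) \<Rightarrow> (x, (- y) mod p)) = z \<and>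
        (case z of (x, y) \<Rightarrow> (x, (- y) mod p)) \<noteq> z"
      using x y e' unfolding xy by (simp add: m C_def twist_points_def)
  qed
  moreover have "card {z \<in> C. snd z = 0} = card Z"
  proof -
    have "(x, 0) \<in> C \<longleftrightarrow> x \<in> Z" for x
    proof -
      have "p dvd D * 0 ^ 2 - (x ^ 3 - 9 * x + 12) \<longleftrightarrow> p dvd - (x ^ 3 - 9 * x + 12)" by simp
      then show ?thesis unfolding dvd_minus_iff
        using p_pos by (simp add: C_def Z_def twist_points_def)
    qed
    then have "{z \<in> C. snd z = 0} = (\<lambda>x. (x, 0)) ` Z" by force
    then show ?thesis by (simp add: card_image inj_on_def)
  qed
  moreover have "odd (card Z)" unfolding Z_def by (rule odd_card_cubic_roots[OF r])
  moreover have "card C = card {z \<in> C. snd z = 0} + card {z \<in> C. snd z \<noteq> 0}"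
    by (subst card_Un_disjoint[symmetric])
      (auto simp: C_def finite_twist_points intro!: arg_cong[of _ _ card])
  ultimately show ?thesis by (simp add: C_def)
qed

lemma common_root_cubic_quartic:
  assumes "p dvd x ^ 4 - 18 * x ^ 2 + 48 * x - 27"
  shows "\<not> p dvd x ^ 3 - 9 * x + 12"
proof
  assume f: "p dvd x ^ 3 - 9 * x + 12"
  have "(3 * (x ^ 2 - 3)) * (3 * (x ^ 2 - 3)) =
      12 * x * (x ^ 3 - 9 * x + 12) - 3 * (x ^ 4 - 18 * x ^ 2 + 48 * x - 27)"
    by algebra
  also have "p dvd \<dots>" by (rule dvd_diff[OF dvd_mult[OF f] dvd_mult[OF assms]])
  finally have "p dvd (3 * (x ^ 2 - 3)) * (3 * (x ^ 2 - 3))" .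
  then have "p dvd 3 * (x ^ 2 - 3)" using prime_dvd_mult_iff[OF p] by blast
  then have r3: "p dvd x ^ 2 - 3" by (simp only: cancel_3)
  then have "p dvd 2 * (3 * (x - 2))" using f by algebra
  then have "p dvd x - 2" by (simp only: cancel_2 cancel_3)
  then have "p dvd 1" using r3 by algebra
  then show False using not_dvd_1 by contradiction
qed

text \<open>
  Translation by the 3-torsion point \<open>(x0, y0)\<close> permutes the points in cycles of length 3.  The
  coordinates used here turn it into a cyclic shift.  Let \<open>l\<close> be the slope of the tangent at this
  flex, \<open>X = x - x0\<close> and \<open>w = y - y0 - l X\<close>; then the curve is
  \<open>D w^2 + 2 D w (y0 + l X) = X^3\<close>.  The points with \<open>X \<noteq> 0\<close> correspond, via \<open>a = w / X\<close>,
  \<open>b = 2 y0 / X\<close> and \<open>c = - X^2 / (D w)\<close>, to the triples with \<open>a + b + c = - 2 l\<close> and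
  \<open>D a b c = - 2 y0\<close>.  There remain the two points with \<open>X = 0\<close>, and infinity.
\<close>

lemma three_dvd_card_twist_points:
  assumes D: "\<not> p dvd D" and x0: "x0 \<in> {0..<p}" and y0: "y0 \<in> {0..<p}"
    and q: "p dvd x0 ^ 4 - 18 * x0 ^ 2 + 48 * x0 - 27"
    and P: "p dvd D * y0 ^ 2 - (x0 ^ 3 - 9 * x0 + 12)"
  shows "3 dvd 1 + card (twist_points p D)"
proof -
  have y0': "\<not> p dvd y0"
  proof
    assume "p dvd y0"
    then have "p dvd x0 ^ 3 - 9 * x0 + 12" using P by algebra
    then show False using common_root_cubic_quartic[OF q] by contradiction
  qed
  then have "\<not> p dvd 2 * D * y0"
    using D by (simp add: prime_dvd_mult_iff[OF p] not_dvd_2)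
  then obtain i where i: "p dvd 2 * D * y0 * i - 1" using inverse_mod by blast
  define l where "l = i * (3 * x0 ^ 2 - 9)"
  have l: "p dvd 2 * D * y0 * l - (3 * x0 ^ 2 - 9)" using i unfolding l_def by algebra
  have "(2 * (2 * (D * (y0 * y0)))) * (D * l ^ 2 - 3 * x0) =
      (2 * D * y0 * l + (3 * x0 ^ 2 - 9)) * (2 * D * y0 * l - (3 * x0 ^ 2 - 9))
      - 12 * x0 * (D * y0 ^ 2 - (x0 ^ 3 - 9 * x0 + 12)) - 3 * (x0 ^ 4 - 18 * x0 ^ 2 + 48 * x0 - 27)"
    by algebra
  also have "p dvd \<dots>" by (rule dvd_diff[OF dvd_diff[OF dvd_mult[OF l] dvd_mult[OF P]] dvd_mult[OF q]])
  finally have "p dvd (2 * (2 * (D * (y0 * y0)))) * (D * l ^ 2 - 3 * x0)" .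
  \<comment> \<open>This expresses that the tangent at \<open>(x0, y0)\<close> meets the curve there with multiplicity 3.\<close>
  then have l2: "p dvd D * l ^ 2 - 3 * x0"
    unfolding prime_dvd_mult_iff[OF p] using D y0' not_dvd_2 by blast
  define T where "T = {(a, b, c). a \<in> {0..<p} \<and> b \<in> {0..<p} \<and> c \<in> {0..<p} \<and>
    p dvd a + b + c + 2 * l \<and> p dvd D * a * b * c + 2 * y0}"
  have finT: "finite T"
    by (rule finite_subset[of _ "{0..<p} \<times> {0..<p} \<times> {0..<p}"]) (auto simp: T_def)
  have "3 dvd card T"
  proof (rule three_dvd_card_cycle[where g = "\<lambda>(a, b, c). (b, c, a)"])
    fix t assume t: "t \<in> T"
    obtain a b c where abc: "t = (a, b, c)" by (cases t) auto
    have "(b, c, a) \<in> T" using t by (simp add: abc T_def mult_ac add_ac)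
    moreover have "(b, c, a) \<noteq> t"
    proof
      assume "(b, c, a) = t"
      \<comment> \<open>A fixed triple would make the curve singular modulo \<open>p\<close>.\<close>
      then have aaa: "t = (a, a, a)" using abc by (metis prod.inject)
      then have s: "p dvd 3 * a + 2 * l" and m: "p dvd D * a ^ 3 + 2 * y0"
        using t unfolding aaa by (simp_all add: T_def power3_eq_cube mult_ac)
      have "2 * (27 * y0 - 4 * D * l ^ 3) = 27 * (D * a ^ 3 + 2 * y0) - D * (9 * a ^ 2 - 6 * a * l + 4 * l ^ 2) * (3 * a + 2 * l)"
        by algebra
      also have "p dvd \<dots>" by (rule dvd_diff[OF dvd_mult[OF m] dvd_mult[OF s]])
      finally have "p dvd 2 * (27 * y0 - 4 * D * l ^ 3)" .
      then have k: "p dvd 27 * y0 - 4 * D * l ^ 3" by (simp only: cancel_2)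
      have "3 * (3 * (x0 ^ 3 - 21 * x0 + 36)) = D * y0 * (27 * y0 - 4 * D * l ^ 3)
          - 27 * (D * y0 ^ 2 - (x0 ^ 3 - 9 * x0 + 12))
          + 6 * x0 * (2 * D * y0 * l - (3 * x0 ^ 2 - 9)) + 4 * D * y0 * l * (D * l ^ 2 - 3 * x0)"
        by algebra
      also have "p dvd \<dots>" by (rule dvd_add[OF dvd_add[OF dvd_diff[OF dvd_mult[OF k] dvd_mult[OF P]] dvd_mult[OF l]] dvd_mult[OF l2]])
      finally have "p dvd 3 * (3 * (x0 ^ 3 - 21 * x0 + 36))" .
      then have c: "p dvd x0 ^ 3 - 21 * x0 + 36" by (simp only: cancel_3)
      have "3 * (x0 ^ 2 + 4 * x0 - 9) = (x0 ^ 4 - 18 * x0 ^ 2 + 48 * x0 - 27) - x0 * (x0 ^ 3 - 21 * x0 + 36)"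
        by algebra
      also have "p dvd \<dots>" by (rule dvd_diff[OF q dvd_mult[OF c]])
      finally have "p dvd 3 * (x0 ^ 2 + 4 * x0 - 9)" .
      then have d: "p dvd x0 ^ 2 + 4 * x0 - 9" by (simp only: cancel_3)
      have "2 * (2 * x0) = (x0 ^ 3 - 21 * x0 + 36) - (x0 - 4) * (x0 ^ 2 + 4 * x0 - 9)"
        by algebra
      also have "p dvd \<dots>" by (rule dvd_diff[OF c dvd_mult[OF d]])
      finally have "p dvd 2 * (2 * x0)" .
      then have "p dvd x0" by (simp only: cancel_2)
      then have "p dvd 3 * (3 * 1)" using d by algebra
      then show False using not_dvd_1 by (simp only: cancel_3)
    qed
    ultimately show "(case t of (a, b, c) \<Rightarrow> (b, c, a)) \<in> T \<and>
        (case (case (case t of (a, b, c) \<Rightarrow> (b, c, a)) of (a, b, c) \<Rightarrow> (b, c, a))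
          of (a, b, c) \<Rightarrow> (b, c, a)) = t \<and>
        (case t of (a, b, c) \<Rightarrow> (b, c, a)) \<noteq> t"
      by (simp add: abc)
  qed (rule finT)
  moreover have "card {z \<in> twist_points p D. fst z \<noteq> x0} = card T"
  proof -
    \<comment> \<open>From \<open>D a b c = - 2 y0\<close> one gets \<open>X = 2 y0 / b = - D a c\<close>.\<close>
    define h where "h = (\<lambda>(a, b :: int, c). ((x0 - D * a * c) mod p, (y0 - (l + a) * (D * a * c)) mod p))"
    have h: "\<exists>x y. h (a, b, c) = (x, y) \<and> x \<in> {0..<p} \<and> y \<in> {0..<p} \<and>
        p dvd x - (x0 - D * a * c) \<and> p dvd y - (y0 - (l + a) * (D * a * c))" for a b c
      using p_pos dvd_mod_self[of p] by (simp add: h_def)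
    have expand: "p dvd D * y ^ 2 - (x ^ 3 - 9 * x + 12) \<longleftrightarrow>
        p dvd D * w ^ 2 + 2 * D * w * (y0 + l * X) - X ^ 3"
      if "X = x - x0" "w = y - y0 - l * X" for x y X w
    proof -
      have "D * y ^ 2 - (x ^ 3 - 9 * x + 12) =
          (D * w ^ 2 + 2 * D * w * (y0 + l * X) - X ^ 3) +
          ((D * y0 ^ 2 - (x0 ^ 3 - 9 * x0 + 12)) + X * (2 * D * y0 * l - (3 * x0 ^ 2 - 9))
           + X ^ 2 * (D * l ^ 2 - 3 * x0))"
        unfolding that by algebra
      moreover have "p dvd (D * y0 ^ 2 - (x0 ^ 3 - 9 * x0 + 12))
          + X * (2 * D * y0 * l - (3 * x0 ^ 2 - 9)) + X ^ 2 * (D * l ^ 2 - 3 * x0)"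
        by (rule dvd_add[OF dvd_add[OF P dvd_mult[OF l]] dvd_mult[OF l2]])
      ultimately show ?thesis by (metis dvd_add_left_iff)
    qed
    have "inj_on h T"
    proof (rule inj_onI)
      fix t t' assume t: "t \<in> T" "t' \<in> T" and eq: "h t = h t'"
      obtain a b c where abc: "t = (a, b, c)" by (cases t) auto
      obtain a' b' c' where abc': "t' = (a', b', c')" by (cases t') auto
      have T1: "a \<in> {0..<p}" "b \<in> {0..<p}" "c \<in> {0..<p}" "p dvd a + b + c + 2 * l"
        "p dvd D * a * b * c + 2 * y0" using t(1) by (simp_all add: abc T_def)
      have T2: "a' \<in> {0..<p}" "b' \<in> {0..<p}" "c' \<in> {0..<p}" "p dvd a' + b' + c' + 2 * l"
        "p dvd D * a' * b' * c' + 2 * y0" using t(2) by (simp_all add: abc' T_def)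
      obtain x y where xy: "p dvd x - (x0 - D * a * c)" "p dvd y - (y0 - (l + a) * (D * a * c))"
        "p dvd x - (x0 - D * a' * c')" "p dvd y - (y0 - (l + a') * (D * a' * c'))"
        using h[of a b c] h[of a' b' c'] eq unfolding abc abc' by auto
      have nz: "\<not> p dvd D * a * c"
      proof
        assume "p dvd D * a * c"
        then have "p dvd 2 * y0" using T1(5) by algebra
        then show False using y0' by (simp only: cancel_2)
      qed
      then have nz': "\<not> p dvd D" "\<not> p dvd a" by auto
      have "p dvd (D * a * c) * (a - a')" using xy by algebra
      then have "p dvd a - a'" using nz p prime_dvd_mult_iff by blast
      then have a: "a = a'" using dvd_residue_eq T1(1) T2(1) by blast
      have "p dvd (D * a) * (c - c')" using xy(1,3) a by algebra
      then have "p dvd c - c'" using nz' p prime_dvd_mult_iff by blast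
      then have c: "c = c'" using dvd_residue_eq T1(3) T2(3) by blast
      have "p dvd b - b'" using T1(4) T2(4) a c by algebra
      then have b: "b = b'" using dvd_residue_eq T1(2) T2(2) by blast
      show "t = t'" using a b c abc abc' by simp
    qed
    moreover have "h ` T = {z \<in> twist_points p D. fst z \<noteq> x0}"
    proof (intro equalityI subsetI)
      fix z assume "z \<in> h ` T"
      then obtain a b c where abc: "(a, b, c) \<in> T" "z = h (a, b, c)" by auto
      have T1: "p dvd a + b + c + 2 * l" "p dvd D * a * b * c + 2 * y0"
        using abc(1) by (simp_all add: T_def)
      obtain x y where xy: "z = (x, y)" "x \<in> {0..<p}" "y \<in> {0..<p}"
        "p dvd x - (x0 - D * a * c)" "p dvd y - (y0 - (l + a) * (D * a * c))"
        using h[of a b c] abc(2) by auto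
      define X w where "X = x - x0" and "w = y - y0 - l * X"
      have Xac: "p dvd X + D * a * c" using xy(4) unfolding X_def by algebra
      then have "p dvd w - a * X" using xy(5) unfolding w_def by algebra
      then have "p dvd D * w ^ 2 + 2 * D * w * (y0 + l * X) - X ^ 3" using Xac T1 by algebra
      then have "p dvd D * y ^ 2 - (x ^ 3 - 9 * x + 12)"
        using expand[OF X_def w_def] by blast
      moreover have "x \<noteq> x0"
      proof
        assume "x = x0"
        then have "p dvd D * a * c" using Xac by (simp add: X_def)
        then have "p dvd 2 * y0" using T1(2) by algebra
        then show False using y0' by (simp only: cancel_2)
      qed
      ultimately show "z \<in> {z \<in> twist_points p D. fst z \<noteq> x0}"
        using xy by (simp add: twist_points_def)
    next
      fix z assume z: "z \<in> {z \<in> twist_points p D. fst z \<noteq> x0}"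
      obtain x y where xy: "z = (x, y)" by (cases z)
      have x: "x \<in> {0..<p}" and y: "y \<in> {0..<p}" and e: "p dvd D * y ^ 2 - (x ^ 3 - 9 * x + 12)"
        and "x \<noteq> x0" using z by (simp_all add: xy twist_points_def)
      then have xx: "\<not> p dvd x - x0" using dvd_residue_eq x0 by blast
      define X w where "X = x - x0" and "w = y - y0 - l * X"
      have G: "p dvd D * w ^ 2 + 2 * D * w * (y0 + l * X) - X ^ 3"
        using e expand[OF X_def w_def] by blast
      have X0: "\<not> p dvd X" using xx by (simp add: X_def)
      have Dw: "\<not> p dvd D * w"
      proof
        assume "p dvd D * w"
        then have "p dvd X ^ 3" using G by algebra
        then show False using X0 p prime_dvd_power by blast
      qed
      obtain i where i: "p dvd X * i - 1" using inverse_mod[OF X0] by blast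
      obtain j where j: "p dvd (D * w) * j - 1" using inverse_mod[OF Dw] by blast
      define a c b where "a = (w * i) mod p" and "c = (- (X ^ 2 * j)) mod p"
        and "b = (- 2 * l - a - c) mod p"
      have abc: "p dvd a - w * i" "p dvd c - (- (X ^ 2 * j))" "p dvd b - (- 2 * l - a - c)"
        unfolding a_def b_def c_def by (rule dvd_mod_self)+
      have s: "p dvd a + b + c + 2 * l" using abc(3) by algebra
      have aX: "p dvd a * X - w" using abc(1) i by algebra
      have cw: "p dvd c * (D * w) + X ^ 2" using abc(2) j by algebra
      have "p dvd X * (D * a * c + X)" using aX cw by algebra
      then have Xac: "p dvd D * a * c + X" using X0 p prime_dvd_mult_iff by blast
      have "p dvd (D * w) * (D * a * b * c + 2 * y0)"
        using Xac s aX cw G by algebra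
      then have m: "p dvd D * a * b * c + 2 * y0" using Dw prime_dvd_mult_iff[OF p] by blast
      have "(a, b, c) \<in> T" using s m p_pos by (simp add: T_def a_def b_def c_def)
      moreover have "h (a, b, c) = z"
      proof -
        obtain x' y' where xy': "h (a, b, c) = (x', y')" "x' \<in> {0..<p}" "y' \<in> {0..<p}"
          "p dvd x' - (x0 - D * a * c)" "p dvd y' - (y0 - (l + a) * (D * a * c))"
          using h[of a b c] by blast
        have "p dvd x' - x" using xy'(4) Xac unfolding X_def by algebra
        then have "x' = x" using dvd_residue_eq xy'(2) x by blast
        moreover have "p dvd y' - y" using xy'(5) Xac aX unfolding X_def w_def by algebra
        then have "y' = y" using dvd_residue_eq xy'(3) y by blast
        ultimately show ?thesis using xy xy'(1) by simp
      qed
      ultimately show "z \<in> h ` T" by force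
    qed
    ultimately show ?thesis by (metis card_image)
  qed
  moreover have "card {z \<in> twist_points p D. fst z = x0} = 2"
  proof -
    have "{z \<in> twist_points p D. fst z = x0} = {(x0, y0), (x0, p - y0)}"
    proof (intro equalityI subsetI)
      fix z assume "z \<in> {z \<in> twist_points p D. fst z = x0}"
      then obtain y where y: "z = (x0, y)" "y \<in> {0..<p}" "p dvd D * y ^ 2 - (x0 ^ 3 - 9 * x0 + 12)"
        by (cases z) (auto simp: twist_points_def)
      have "p dvd D * ((y - y0) * (y + y0))" using y(3) P by algebra
      then have "p dvd y - y0 \<or> p dvd y + y0" using D prime_dvd_mult_iff[OF p] by blast
      then show "z \<in> {(x0, y0), (x0, p - y0)}"
      proof
        assume "p dvd y - y0"
        then have "y = y0" using dvd_residue_eq y(2) y0 by blast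
        then show ?thesis using y(1) by simp
      next
        assume "p dvd y + y0"
        then have "p dvd y - (p - y0)" by algebra
        moreover have "p - y0 \<in> {0..<p}" using y0 y0' by (cases "y0 = 0") auto
        ultimately have "y = p - y0" using dvd_residue_eq y(2) by blast
        then show ?thesis using y(1) by simp
      qed
    next
      fix z assume z: "z \<in> {(x0, y0), (x0, p - y0)}"
      have "p dvd D * (p - y0) ^ 2 - (x0 ^ 3 - 9 * x0 + 12)" using P by algebra
      moreover have "p - y0 \<in> {0..<p}" using y0 y0' by (cases "y0 = 0") auto
      ultimately show "z \<in> {z \<in> twist_points p D. fst z = x0}"
        using z x0 y0 P by (auto simp: twist_points_def)
    qed
    moreover have "y0 \<noteq> p - y0"
    proof
      assume "y0 = p - y0"
      then have "p = 2 * y0" by simp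
      then have "p dvd 2 * y0" by simp
      then show False using y0' by (simp only: cancel_2)
    qed
    ultimately show ?thesis by simp
  qed
  moreover have "card (twist_points p D) =
      card {z \<in> twist_points p D. fst z = x0} + card {z \<in> twist_points p D. fst z \<noteq> x0}"
    by (subst card_Un_disjoint[symmetric])
      (auto simp: finite_twist_points intro!: arg_cong[of _ _ card])
  ultimately show ?thesis by presburger
qed

end

definition square_fibre :: "int \<Rightarrow> int \<Rightarrow> int \<Rightarrow> int set" where
  "square_fibre p D z = {y \<in> {0..<p}. p dvd D * y ^ 2 - z}"

lemma finite_square_fibre: "finite (square_fibre p D z)"
  by (rule finite_subset[of _ "{0..<p}"]) (auto simp: square_fibre_def)

context
  fixes p :: int
  assumes p: "prime p" and p3: "p > 3"
begin

lemma card_scaled_square_fibre_le: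
  assumes "\<not> p dvd D"
  shows "card (square_fibre p D z) \<le> 2"
proof (cases "square_fibre p D z = {}")
  case False
  then obtain y where y: "y \<in> {0..<p}" "p dvd D * y ^ 2 - z"
    by (auto simp: square_fibre_def)
  have "square_fibre p D z \<subseteq> {y, (- y) mod p}"
  proof
    fix x assume "x \<in> square_fibre p D z"
    then have x: "x \<in> {0..<p}" "p dvd D * x ^ 2 - z" by (simp_all add: square_fibre_def)
    have "p dvd D * ((x - y) * (x + y))" using x(2) y(2) by algebra
    then have "p dvd x - y \<or> p dvd x + y" using assms prime_dvd_mult_iff[OF p] by blast
    then show "x \<in> {y, (- y) mod p}"
    proof
      assume "p dvd x - y"
      then have "x = y" using dvd_residue_eq x(1) y(1) by blast
      then show ?thesis by simp
    next
      assume "p dvd x + y"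
      moreover have "p dvd (- y) mod p - (- y)" by (rule dvd_mod_self)
      ultimately have "p dvd x - (- y) mod p" by algebra
      moreover have "(- y) mod p \<in> {0..<p}" using p3 by simp
      ultimately have "x = (- y) mod p" using dvd_residue_eq x(1) by blast
      then show ?thesis by simp
    qed
  qed
  then have "card (square_fibre p D z) \<le> card {y, (- y) mod p}"
    by (intro card_mono) auto
  also have "\<dots> \<le> 2" by (simp add: card_insert_if)
  finally show ?thesis .
qed simp

lemma sum_card_scaled_square_fibre:
  "(\<Sum>z\<in>{0..<p}. card (square_fibre p D z)) = nat p"
proof -
  have "(\<Sum>z\<in>{0..<p}. card (square_fibre p D z)) =
      card (Sigma {0..<p} (square_fibre p D))"
    by (rule card_SigmaI[symmetric]) (auto simp: finite_square_fibre)
  also have "(Sigma {0..<p} (square_fibre p D)) =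
      (\<lambda>y. ((D * y ^ 2) mod p, y)) ` {0..<p}"
  proof (intro equalityI subsetI)
    fix t assume "t \<in> (Sigma {0..<p} (square_fibre p D))"
    then obtain z y where zy: "t = (z, y)" "z \<in> {0..<p}" "y \<in> {0..<p}" "p dvd D * y ^ 2 - z"
      by (auto simp: square_fibre_def)
    have "z = (D * y ^ 2) mod p" using zy(2,4) by (metis mod_eq_dvd_iff atLeastLessThan_iff mod_pos_pos_trivial)
    then show "t \<in> (\<lambda>y. ((D * y ^ 2) mod p, y)) ` {0..<p}" using zy by blast
  next
    fix t assume "t \<in> (\<lambda>y. ((D * y ^ 2) mod p, y)) ` {0..<p}"
    then obtain y where y: "t = ((D * y ^ 2) mod p, y)" "y \<in> {0..<p}" by blast
    have "p dvd D * y ^ 2 - (D * y ^ 2) mod p" by (rule dvd_minus_mod)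
    then show "t \<in> (Sigma {0..<p} (square_fibre p D))"
      using y p3 by (simp add: square_fibre_def)
  qed
  also have "card \<dots> = nat p" by (subst card_image) (auto simp: inj_on_def)
  finally show ?thesis .
qed

lemma card_twist_points_eq_sum:
  "card (twist_points p D) =
    (\<Sum>x\<in>{0..<p}. card (square_fibre p D ((x ^ 3 - 9 * x + 12) mod p)))"
proof -
  have "p dvd D * y ^ 2 - z mod p \<longleftrightarrow> p dvd D * y ^ 2 - z" for y z
    by (metis mod_eq_dvd_iff mod_mod_trivial)
  then have "twist_points p D =
      Sigma {0..<p} (\<lambda>x. square_fibre p D ((x ^ 3 - 9 * x + 12) mod p))"
    unfolding twist_points_def square_fibre_def by blast
  then show ?thesis by (simp add: card_SigmaI finite_square_fibre)
qed

text \<open>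
  If \<open>D' / D\<close> is a nonresidue, then for no \<open>z \<noteq> 0\<close> both \<open>z / D\<close> and \<open>z / D'\<close> are squares, so the
  two fibres over any \<open>z\<close> have together at most 2 elements.  In total they have \<open>2 p\<close> elements, hence
  exactly 2 over every \<open>z\<close>, and so over every value of the cubic.
\<close>

lemma card_complementary_twists:
  assumes D: "\<not> p dvd D" and D': "\<not> p dvd D'" and ns: "\<And>y. \<not> p dvd D * y ^ 2 - D'"
  shows "card (twist_points p D) + card (twist_points p D') = 2 * nat p"
proof -
  define F where "F = square_fibre p"
  have le: "card (F D z) + card (F D' z) \<le> 2" if z: "z \<in> {0..<p}" for z
  proof (cases "z = 0")
    case True
    have "F e z \<subseteq> {0}" if "\<not> p dvd e" for e
    proof
      fix y assume "y \<in> F e z"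
      then have y: "y \<in> {0..<p}" "p dvd e * y ^ 2" using True by (simp_all add: F_def square_fibre_def)
      then have "p dvd y" using that prime_dvd_mult_iff[OF p] prime_dvd_power[OF p] by blast
      then have "p dvd y - 0" by simp
      then have "y = 0" using dvd_residue_eq y(1) p3 by (metis atLeastLessThan_iff order.refl order.strict_trans zero_less_numeral)
      then show "y \<in> {0}" by simp
    qed
    then have "card (F e z) \<le> 1" if "\<not> p dvd e" for e
      using card_mono[of "{0}" "F e z"] that by simp
    from this[OF D] this[OF D'] show ?thesis by simp
  next
    case False
    have "F D z = {} \<or> F D' z = {}"
    proof (rule ccontr)
      assume "\<not> (F D z = {} \<or> F D' z = {})"
      then obtain y y' where y: "p dvd D * y ^ 2 - z" "p dvd D' * y' ^ 2 - z"
        by (auto simp: F_def square_fibre_def)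
      have "\<not> p dvd y'"
      proof
        assume "p dvd y'"
        then have "p dvd z - 0" using y(2) by algebra
        then have "z = 0" using dvd_residue_eq[of z p 0] z p3 by simp
        then show False using False by contradiction
      qed
      then obtain i where "p dvd y' * i - 1" using inverse_mod[OF p p3] by blast
      then have "p dvd D * (y * i) ^ 2 - D'" using y by algebra
      then show False using ns by blast
    qed
    then show ?thesis
      using card_scaled_square_fibre_le[OF D, of z] card_scaled_square_fibre_le[OF D', of z]
      unfolding F_def by (metis add.left_neutral add.right_neutral card.empty)
  qed
  have "(\<Sum>z\<in>{0..<p}. card (F D z) + card (F D' z)) = (\<Sum>z\<in>{0..<p}. 2)"
    using sum_card_scaled_square_fibre by (simp add: sum.distrib F_def)
  then have eq: "card (F D z) + card (F D' z) = 2" if "z \<in> {0..<p}" for z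
    using sum_mono_inv[of "\<lambda>z. card (F D z) + card (F D' z)" "{0..<p}" "\<lambda>_. 2"] le that by simp
  have "card (twist_points p D) + card (twist_points p D') =
      (\<Sum>x\<in>{0..<p}. card (F D ((x ^ 3 - 9 * x + 12) mod p)) + card (F D' ((x ^ 3 - 9 * x + 12) mod p)))"
    by (simp add: card_twist_points_eq_sum sum.distrib F_def)
  also have "\<dots> = (\<Sum>x\<in>{0..<p}. 2)"
    by (intro sum.cong refl eq) (use p3 in simp)
  finally show ?thesis by simp
qed

text \<open>
  With infinity, the twist by \<open>D\<close> has \<open>n\<close> points and the complementary twist has \<open>2 p + 2 - n\<close>.  At a
  root \<open>x0\<close> of the quartic, a point of order 3 lies on the first of them if \<open>f(x0) / D\<close> is a
  square modulo \<open>p\<close>, where \<open>f\<close> is the cubic, and on the second otherwise, as the point \<open>(x0, 1)\<close> of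
  the twist by \<open>f(x0)\<close>.
\<close>

lemma twist_points_divisibility:
  assumes D: "\<not> p dvd D"
  defines "n \<equiv> int (card (twist_points p D)) + 1"
  shows "2 dvd n \<or> 3 dvd n \<or> 3 dvd 2 * p + 2 - n"
proof -
  obtain x where "p dvd x ^ 3 - 9 * x + 12 \<or> p dvd x ^ 4 - 18 * x ^ 2 + 48 * x - 27"
    using cubic_or_quartic_root[OF p p3] by blast
  then show ?thesis
  proof
    assume "p dvd x ^ 3 - 9 * x + 12"
    then show ?thesis using odd_card_twist_points[OF p p3, of x D] by (simp add: n_def)
  next
    assume qx: "p dvd x ^ 4 - 18 * x ^ 2 + 48 * x - 27"
    define x0 where "x0 = x mod p"
    have "p dvd x0 - x" unfolding x0_def by (rule dvd_mod_self)
    then have q: "p dvd x0 ^ 4 - 18 * x0 ^ 2 + 48 * x0 - 27" using qx by algebra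
    have x0: "x0 \<in> {0..<p}" using p3 by (simp add: x0_def)
    show ?thesis
    proof (cases "\<exists>y. p dvd D * y ^ 2 - (x0 ^ 3 - 9 * x0 + 12)")
      case True
      then obtain y where y: "p dvd D * y ^ 2 - (x0 ^ 3 - 9 * x0 + 12)" by blast
      define y0 where "y0 = y mod p"
      have "p dvd y0 - y" unfolding y0_def by (rule dvd_mod_self)
      then have P: "p dvd D * y0 ^ 2 - (x0 ^ 3 - 9 * x0 + 12)" using y by algebra
      have y0: "y0 \<in> {0..<p}" using p3 by (simp add: y0_def)
      have "3 dvd 1 + card (twist_points p D)"
        by (rule three_dvd_card_twist_points[OF p p3 D x0 y0 q P])
      then have "int 3 dvd int (1 + card (twist_points p D))" by (simp only: int_dvd_int_iff)
      then show ?thesis by (simp add: n_def add.commute)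
    next
      case False
      define D' where "D' = x0 ^ 3 - 9 * x0 + 12"
      have D': "\<not> p dvd D'" unfolding D'_def by (rule common_root_cubic_quartic[OF p p3 q])
      have P: "p dvd D' * 1 ^ 2 - (x0 ^ 3 - 9 * x0 + 12)" by (simp add: D'_def)
      have "1 \<in> {0..<p}" using p3 by simp
      then have "3 dvd 1 + card (twist_points p D')"
        using three_dvd_card_twist_points[OF p p3 D' x0 _ q P] by blast
      then have "int 3 dvd int (1 + card (twist_points p D'))" by (simp only: int_dvd_int_iff)
      moreover have "card (twist_points p D) + card (twist_points p D') = 2 * nat p"
        using card_complementary_twists[OF D D'] False unfolding D'_def by blast
      then have "int (card (twist_points p D)) + int (card (twist_points p D')) = 2 * p"
        using p3 by linarith
      then have "2 * p + 2 - n = int (1 + card (twist_points p D'))" by (simp add: n_def)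
      ultimately show ?thesis by (metis of_nat_numeral)
    qed
  qed
qed

end

section \<open>Models with good reduction\<close>

definition b2_inv :: "'a::comm_ring_1 weierstrass \<Rightarrow> 'a" where
  "b2_inv M = wa1 M ^ 2 + 4 * wa2 M"

definition b4_inv :: "'a::comm_ring_1 weierstrass \<Rightarrow> 'a" where
  "b4_inv M = 2 * wa4 M + wa1 M * wa3 M"

definition b6_inv :: "'a::comm_ring_1 weierstrass \<Rightarrow> 'a" where
  "b6_inv M = wa3 M ^ 2 + 4 * wa6 M"

definition c4_inv :: "'a::comm_ring_1 weierstrass \<Rightarrow> 'a" where
  "c4_inv M = b2_inv M ^ 2 - 24 * b4_inv M"

definition c6_inv :: "'a::comm_ring_1 weierstrass \<Rightarrow> 'a" where
  "c6_inv M = - (b2_inv M ^ 3) + 36 * b2_inv M * b4_inv M - 216 * b6_inv M"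

lemma c4_c6_discriminant:
  "c4_inv M ^ 3 - c6_inv M ^ 2 = 1728 * discriminant M" for M :: "int weierstrass"
  unfolding c4_inv_def c6_inv_def b2_inv_def b4_inv_def b6_inv_def discriminant_def Let_def
  by algebra

text \<open>
  For \<open>E_u\<close> itself \<open>c4 = 432 u^2\<close> and \<open>c6 = - 10368 u^3\<close>.  A change of model by \<open>v\<close> divides them by \<open>v^4\<close>
  and \<open>v^6\<close>, which leaves the relation intact.  It says that all the curves \<open>E_u\<close> have the same
  \<open>j\<close>-invariant.
\<close>

lemma E_curve_model_c4_c6:
  fixes M :: "int weierstrass"
  assumes "weierstrass_iso (E_curve u) (map_weierstrass of_int M)"
  shows "4 * c4_inv M ^ 3 = 3 * c6_inv M ^ 2"
proof -
  define U A1 A2 A3 A4 A6 :: rat where "U = of_int u" and "A1 = of_int (wa1 M)"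
    and "A2 = of_int (wa2 M)" and "A3 = of_int (wa3 M)" and "A4 = of_int (wa4 M)"
    and "A6 = of_int (wa6 M)"
  obtain v r s t where v: "v \<noteq> 0"
    and e1: "v * A1 = 2 * s" and e2: "v ^ 2 * A2 = 3 * r - s ^ 2" and e3: "v ^ 3 * A3 = 2 * t"
    and e4: "v ^ 4 * A4 = - 9 * U ^ 2 + 3 * r ^ 2 - 2 * s * t"
    and e6: "v ^ 6 * A6 = 12 * U ^ 3 + r * (- 9 * U ^ 2) + r ^ 3 - t ^ 2"
    using assms unfolding weierstrass_iso_def
    by (cases M) (auto simp: E_curve_def U_def A1_def A2_def A3_def A4_def A6_def)
  define B2 B4 B6 where "B2 = A1 ^ 2 + 4 * A2" and "B4 = 2 * A4 + A1 * A3" and "B6 = A3 ^ 2 + 4 * A6"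
  have b2: "v ^ 2 * B2 = 12 * r" using e1 e2 unfolding B2_def by algebra
  have b4: "v ^ 4 * B4 = 6 * r ^ 2 - 18 * U ^ 2"
  proof -
    have "v ^ 4 * B4 = 2 * (v ^ 4 * A4) + (v * A1) * (v ^ 3 * A3)" unfolding B4_def by algebra
    also have "\<dots> = 6 * r ^ 2 - 18 * U ^ 2" unfolding e1 e3 e4 by algebra
    finally show ?thesis .
  qed
  have b6: "v ^ 6 * B6 = 4 * r ^ 3 - 36 * U ^ 2 * r + 48 * U ^ 3"
  proof -
    have "v ^ 6 * B6 = (v ^ 3 * A3) ^ 2 + 4 * (v ^ 6 * A6)" unfolding B6_def by algebra
    also have "\<dots> = 4 * r ^ 3 - 36 * U ^ 2 * r + 48 * U ^ 3" unfolding e3 e6 by algebra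
    finally show ?thesis .
  qed
  define C4 C6 where "C4 = B2 ^ 2 - 24 * B4" and "C6 = - (B2 ^ 3) + 36 * B2 * B4 - 216 * B6"
  have c4: "v ^ 4 * C4 = 432 * U ^ 2"
  proof -
    have "v ^ 4 * C4 = (v ^ 2 * B2) ^ 2 - 24 * (v ^ 4 * B4)" unfolding C4_def by algebra
    also have "\<dots> = 432 * U ^ 2" unfolding b2 b4 by algebra
    finally show ?thesis .
  qed
  have c6: "v ^ 6 * C6 = - 10368 * U ^ 3"
  proof -
    have "v ^ 6 * C6 = - ((v ^ 2 * B2) ^ 3) + 36 * (v ^ 2 * B2) * (v ^ 4 * B4) - 216 * (v ^ 6 * B6)"
      unfolding C6_def by algebra
    also have "\<dots> = - 10368 * U ^ 3" unfolding b2 b4 b6 by algebra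
    finally show ?thesis .
  qed
  have "v ^ 12 * (4 * C4 ^ 3) = 4 * (v ^ 4 * C4) ^ 3" by algebra
  also have "\<dots> = 3 * (v ^ 6 * C6) ^ 2" unfolding c4 c6 by algebra
  also have "\<dots> = v ^ 12 * (3 * C6 ^ 2)" by algebra
  finally have "4 * C4 ^ 3 = 3 * C6 ^ 2" using v by simp
  moreover have "C4 = of_int (c4_inv M)" "C6 = of_int (c6_inv M)"
    by (simp_all add: C4_def C6_def B2_def B4_def B6_def A1_def A2_def A3_def A4_def A6_def
        c4_inv_def c6_inv_def b2_inv_def b4_inv_def b6_inv_def)
  ultimately have "(of_int (4 * c4_inv M ^ 3) :: rat) = of_int (3 * c6_inv M ^ 2)" by simp
  then show ?thesis by (simp only: of_int_eq_iff)
qed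

lemma E_curve_model_c4_discriminant:
  fixes M :: "int weierstrass"
  assumes "weierstrass_iso (E_curve u) (map_weierstrass of_int M)"
  shows "c4_inv M ^ 3 = - 5184 * discriminant M"
  using E_curve_model_c4_c6[OF assms] c4_c6_discriminant[of M] by linarith

text \<open>
  In \<open>c4^3 = - 2^6 3^4 \<Delta>\<close> the exponent 4 is not a multiple of 3, which excludes 3.  If \<open>\<Delta>\<close> were odd,
  then \<open>c4\<close> would be divisible by 4 but not by 8; but in a model with integral
  coefficients, \<open>c4\<close> is divisible by 16 as soon as it is even.
\<close>

lemma E_curve_good_prime_gt_3:
  assumes p: "prime p" and M: "good_model (E_curve u) p M"
  shows "p > 3"
proof (rule ccontr)
  assume "\<not> p > 3"
  then consider "p = 2" | "p = 3" using prime_ge_2_nat[OF p] by linarith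
  then show False
  proof cases
    case 1
    then have odd: "odd (discriminant M)" using M by (simp add: good_model_def)
    have eq: "c4_inv M ^ 3 = - 5184 * discriminant M"
      using M by (intro E_curve_model_c4_discriminant[of u]) (simp add: good_model_def)
    then have "even (c4_inv M ^ 3)" by simp
    then have "even (c4_inv M)" by simp
    then have "even (b2_inv M)" by (simp add: c4_inv_def)
    then have "even (wa1 M)" by (simp add: b2_inv_def)
    then obtain a where a: "wa1 M = 2 * a" by blast
    have "c4_inv M = 16 * ((a ^ 2 + wa2 M) ^ 2 - 3 * (wa4 M + a * wa3 M))"
      unfolding c4_inv_def b2_inv_def b4_inv_def a by algebra
    then obtain e where "c4_inv M = 16 * e" by blast
    then have "64 * (64 * e ^ 3) = 64 * (- 81 * discriminant M)" using eq by (simp add: power_mult_distrib)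
    then have "81 * discriminant M = 2 * (- 32 * e ^ 3)" by simp
    then have "even (81 * discriminant M)" by (metis dvd_triv_left)
    then show False using odd by simp
  next
    case 2
    then have nd: "\<not> 3 dvd discriminant M" using M by (simp add: good_model_def)
    have eq: "c4_inv M ^ 3 = - 5184 * discriminant M"
      using M by (intro E_curve_model_c4_discriminant[of u]) (simp add: good_model_def)
    have p3: "prime (3::int)" by simp
    have "c4_inv M ^ 3 = 3 * (- 1728 * discriminant M)" using eq by simp
    then have "3 dvd c4_inv M" using prime_dvd_power[OF p3] by (metis dvd_triv_left)
    then obtain k where k: "c4_inv M = 3 * k" by blast
    then have "k ^ 3 = 3 * (- 64 * discriminant M)" using eq by (simp add: power_mult_distrib)
    then have "3 dvd k" using prime_dvd_power[OF p3] by (metis dvd_triv_left)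
    then obtain m where "k = 3 * m" by blast
    then have "9 * m ^ 3 = - 64 * discriminant M" using \<open>k ^ 3 = _\<close> by (simp add: power_mult_distrib)
    then have "discriminant M = 3 * (- 3 * m ^ 3 - 21 * discriminant M)" by simp
    then have "3 dvd discriminant M" by (metis dvd_triv_left)
    then show False using nd by contradiction
  qed
qed

lemma card_eq_if_injective_grid:
  assumes "finite G" and "inj_on g G" and "g ` G \<subseteq> G"
    and "\<And>z. z \<in> G \<Longrightarrow> P z \<longleftrightarrow> Q (g z)"
  shows "card {z \<in> G. P z} = card {z \<in> G. Q z}"
proof -
  have gG: "g ` G = G" using assms(1-3) by (simp add: endo_inj_surj)
  have "{z \<in> G. Q z} = g ` {z \<in> G. P z}"
  proof (intro equalityI subsetI)
    fix z assume z: "z \<in> {z \<in> G. Q z}"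
    then have "z \<in> g ` G" using gG by simp
    then obtain w where w: "w \<in> G" "z = g w" by (elim imageE)
    then have "P w" using z assms(4)[OF w(1)] by simp
    then show "z \<in> g ` {z \<in> G. P z}" using w by simp
  next
    fix z assume "z \<in> g ` {z \<in> G. P z}"
    then obtain w where w: "w \<in> G" "P w" "z = g w" by auto
    then have "z \<in> g ` G" by simp
    then show "z \<in> {z \<in> G. Q z}" using gG w assms(4)[OF w(1)] by simp
  qed
  then show ?thesis using assms(2) by (simp add: card_image inj_on_subset)
qed

text \<open>
  Modulo \<open>p\<close> the relation between the invariants has the solution \<open>c4 = 3 s^2\<close>, \<open>c6 = 6 s^3\<close>
  with \<open>s = c6 / (2 c4)\<close>.  The reduction has the equation \<open>\<eta>^2 = \<xi>^3 - 27 c4 \<xi> - 54 c6\<close>, and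
  \<open>\<xi> = - 3 s X\<close>, \<open>\<eta> = 9 s^2 Y\<close> transforms it into \<open>- 3 s Y^2 = X^3 - 9 X + 12\<close>.
\<close>

lemma card_points_mod_eq_twist:
  assumes p: "prime p" and M: "good_model (E_curve u) p M"
  obtains D where "\<not> int p dvd D" and "card (points_mod M p) = 1 + card (twist_points (int p) D)"
proof -
  define P where "P = int p"
  have P: "prime P" and P3: "P > 3" using p E_curve_good_prime_gt_3[OF p M] by (simp_all add: P_def)
  have nd: "\<not> P dvd discriminant M" and iso: "weierstrass_iso (E_curve u) (map_weierstrass of_int M)"
    using M by (simp_all add: good_model_def P_def)
  define a1 a2 a3 a4 a6 where "a1 = wa1 M" and "a2 = wa2 M" and "a3 = wa3 M" and "a4 = wa4 M"
    and "a6 = wa6 M"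
  define b2 b4 b6 c4 c6 where "b2 = b2_inv M" and "b4 = b4_inv M" and "b6 = b6_inv M"
    and "c4 = c4_inv M" and "c6 = c6_inv M"
  have n2: "\<not> P dvd 2" and n3: "\<not> P dvd 3" by (rule not_dvd_2[OF P P3] not_dvd_3[OF P P3])+
  have c4c6: "4 * c4 ^ 3 = 3 * c6 ^ 2" unfolding c4_def c6_def by (rule E_curve_model_c4_c6[OF iso])
  have nc4: "\<not> P dvd c4"
  proof
    assume "P dvd c4"
    then have "P dvd - (c4 ^ 3)" using prime_dvd_cube_iff[OF P] by simp
    also have "- (c4 ^ 3) = 2 * (2 * (2 * (2 * (2 * (2 * (3 * (3 * (3 * (3 * discriminant M)))))))))"
      using E_curve_model_c4_discriminant[OF iso] by (simp add: c4_def)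
    finally have "P dvd discriminant M" by (simp only: cancel_2[OF P P3] cancel_3[OF P P3])
    then show False using nd by contradiction
  qed
  then have "\<not> P dvd 2 * c4" by (simp only: cancel_2[OF P P3]) simp
  then obtain i where i: "P dvd (2 * c4) * i - 1" using inverse_mod[OF P P3] by blast
  define s where "s = c6 * i"
  have s1: "P dvd 2 * c4 * s - c6" using i unfolding s_def by algebra
  have "P dvd 2 * (2 * (c4 ^ 2 * (c4 - 3 * s ^ 2)))"
  proof -
    have "2 * (2 * (c4 ^ 2 * (c4 - 3 * s ^ 2))) =
        (4 * c4 ^ 3 - 3 * c6 ^ 2) - 3 * (2 * c4 * s + c6) * (2 * c4 * s - c6)" by algebra
    also have "P dvd \<dots>" using s1 c4c6 by simp
    finally show ?thesis .
  qed
  then have "P dvd c4 ^ 2 * (c4 - 3 * s ^ 2)" by (simp only: cancel_2[OF P P3])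
  then have s2: "P dvd c4 - 3 * s ^ 2"
    using nc4 prime_dvd_mult_iff[OF P] prime_dvd_power[OF P] by blast
  have s3: "P dvd c6 - 6 * s ^ 3" using s1 s2 by algebra
  have ns: "\<not> P dvd s"
  proof
    assume "P dvd s"
    then have "P dvd c4" using s2 by algebra
    then show False using nc4 by contradiction
  qed
  then obtain t where t: "P dvd s * t - 1" using inverse_mod[OF P P3] by blast
  have nt: "\<not> P dvd t"
  proof
    assume "P dvd t"
    then have "P dvd 1" using t by algebra
    then show False using not_dvd_1[OF P P3] by contradiction
  qed
  define D where "D = - 3 * s"
  have nD: "\<not> P dvd D" unfolding D_def using ns n3 prime_dvd_mult_iff[OF P] by simp
  \<comment> \<open>\<open>t\<close> is the inverse of \<open>s\<close>, and \<open>g\<close> maps the given coordinates to \<open>(X, Y)\<close>.\<close>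
  define g where "g = (\<lambda>(x, y). ((- (12 * x + b2) * t) mod P, (12 * (2 * y + a1 * x + a3) * t ^ 2) mod P))"
  define G where "G = {0..<P} \<times> {0..<P}"
  define e where "e x y = y ^ 2 + a1 * x * y + a3 * y - (x ^ 3 + a2 * x ^ 2 + a4 * x + a6)" for x y
  have g: "\<exists>X Y. g (x, y) = (X, Y) \<and> (X, Y) \<in> G \<and> P dvd X - (- (12 * x + b2) * t) \<and>
      P dvd Y - 12 * (2 * y + a1 * x + a3) * t ^ 2" for x y
    using P3 dvd_mod_self[of P] by (simp add: g_def G_def)
  have "card {z \<in> G. P dvd e (fst z) (snd z)} =
      card {z \<in> G. P dvd D * snd z ^ 2 - (fst z ^ 3 - 9 * fst z + 12)}"
  proof (rule card_eq_if_injective_grid)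
    show "finite G" by (simp add: G_def)
    show "g ` G \<subseteq> G" using g by (metis image_subsetI surj_pair)
    show "inj_on g G"
    proof (rule inj_onI)
      fix z z' assume z: "z \<in> G" "z' \<in> G" and eq: "g z = g z'"
      obtain x y x' y' where xy: "z = (x, y)" "z' = (x', y')" by (cases z; cases z')
      obtain X Y where XY: "P dvd X - (- (12 * x + b2) * t)" "P dvd X - (- (12 * x' + b2) * t)"
        "P dvd Y - 12 * (2 * y + a1 * x + a3) * t ^ 2" "P dvd Y - 12 * (2 * y' + a1 * x' + a3) * t ^ 2"
        using g[of x y] g[of x' y'] eq unfolding xy by auto
      have "P dvd t * (2 * (2 * (3 * (x - x'))))" using XY(1,2) by algebra
      then have "P dvd 2 * (2 * (3 * (x - x')))" using nt prime_dvd_mult_iff[OF P] by blast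
      then have "P dvd x - x'" by (simp only: cancel_2[OF P P3] cancel_3[OF P P3])
      then have x: "x = x'" using dvd_residue_eq z xy by (auto simp: G_def)
      have "P dvd t ^ 2 * (2 * (2 * (2 * (3 * (y - y')))))" using XY(3,4) unfolding x by algebra
      then have "P dvd 2 * (2 * (2 * (3 * (y - y'))))"
        using nt prime_dvd_mult_iff[OF P] prime_dvd_power[OF P] by blast
      then have "P dvd y - y'" by (simp only: cancel_2[OF P P3] cancel_3[OF P P3])
      then have "y = y'" using dvd_residue_eq z xy by (auto simp: G_def)
      with x show "z = z'" by (simp add: xy)
    qed
    fix z assume "z \<in> G"
    obtain x y where z: "z = (x, y)" by (cases z)
    obtain X Y where XY: "g z = (X, Y)" "P dvd X - (- (12 * x + b2) * t)"
      "P dvd Y - 12 * (2 * y + a1 * x + a3) * t ^ 2" using g[of x y] unfolding z by blast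
    define xi eta where "xi = 3 * (12 * x + b2)" and "eta = 108 * (2 * y + a1 * x + a3)"
    have "46656 = 2 ^ 6 * (3::int) ^ 6" "- 27 * s ^ 3 = - (3 ^ 3) * s ^ 3" by simp_all
    then have n46656: "\<not> P dvd 46656" and n27: "\<not> P dvd - 27 * s ^ 3"
      using n2 n3 ns prime_dvd_mult_iff[OF P] prime_dvd_power[OF P] by (metis, metis dvd_minus_iff)
    \<comment> \<open>The factor \<open>46656 = 6^6\<close> is a unit modulo \<open>p\<close>.\<close>
    have std: "46656 * e x y = eta ^ 2 - (xi ^ 3 - 27 * c4 * xi - 54 * c6)"
      unfolding e_def eta_def xi_def c4_def c6_def c4_inv_def c6_inv_def b2_def b2_inv_def b4_inv_def
        b6_inv_def a1_def a2_def a3_def a4_def a6_def by algebra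
    have xi: "P dvd xi + 3 * s * X" using XY(2) t unfolding xi_def by algebra
    have eta: "P dvd eta - 9 * s ^ 2 * Y" using XY(3) t unfolding eta_def by algebra
    have "P dvd 46656 * e x y - (- 27 * s ^ 3 * (D * Y ^ 2 - (X ^ 3 - 9 * X + 12)))"
      using xi eta s2 s3 unfolding std D_def by algebra
    then have "P dvd 46656 * e x y \<longleftrightarrow> P dvd - 27 * s ^ 3 * (D * Y ^ 2 - (X ^ 3 - 9 * X + 12))"
      by (metis dvd_diff_commute dvd_add_right_iff diff_add_cancel)
    then have "P dvd e x y \<longleftrightarrow> P dvd D * Y ^ 2 - (X ^ 3 - 9 * X + 12)"
      using n46656 n27 unfolding prime_dvd_mult_iff[OF P, of 46656]
        prime_dvd_mult_iff[OF P, of "- 27 * s ^ 3"] by blast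
    then show "P dvd e (fst z) (snd z) \<longleftrightarrow> P dvd D * snd (g z) ^ 2 - (fst (g z) ^ 3 - 9 * fst (g z) + 12)"
      unfolding XY(1) fst_conv snd_conv unfolding z fst_conv snd_conv .
  qed
  moreover have "{z \<in> G. P dvd D * snd z ^ 2 - (fst z ^ 3 - 9 * fst z + 12)} = twist_points P D"
    by (auto simp: G_def twist_points_def)
  moreover have "points_mod M p = insert PtInf ((\<lambda>(x, y). Pt x y) ` {z \<in> G. P dvd e (fst z) (snd z)})"
    by (auto simp: points_mod_def G_def e_def P_def cong_iff_dvd_diff a1_def a2_def a3_def a4_def a6_def)
  moreover have "card (insert PtInf ((\<lambda>(x, y). Pt x y) ` {z \<in> G. P dvd e (fst z) (snd z)})) =
      1 + card {z \<in> G. P dvd e (fst z) (snd z)}"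
    by (subst card_insert_disjoint, force simp: G_def, force, subst card_image)
      (auto simp: inj_on_def)
  ultimately show ?thesis using that[of D] nD unfolding P_def by simp
qed

lemma A_at_not_coprime_6:
  assumes p: "prime p" and good: "good_reduction (E_curve u) p" and k: "6 dvd k"
  shows "gcd (A_at (E_curve u) p) (int k) \<noteq> 1"
proof -
  define M where "M = (SOME M. good_model (E_curve u) p M)"
  have M: "good_model (E_curve u) p M"
    using good unfolding good_reduction_def M_def by (rule someI_ex)
  have p3: "int p > 3" using E_curve_good_prime_gt_3[OF p M] by simp
  obtain D where D: "\<not> int p dvd D" "card (points_mod M p) = 1 + card (twist_points (int p) D)"
    by (rule card_points_mod_eq_twist[OF p M])
  define n where "n = int (card (twist_points (int p) D)) + 1"
  have "A_at (E_curve u) p = (int p + 1) ^ 2 - (int p + 1 - n) ^ 2"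
    unfolding A_at_def frobenius_trace_def M_def[symmetric] D(2) n_def by simp
  also have "\<dots> = n * (2 * int p + 2 - n)" by algebra
  finally have A: "A_at (E_curve u) p = n * (2 * int p + 2 - n)" .
  have "prime (int p)" using p by simp
  then have "2 dvd n \<or> 3 dvd n \<or> 3 dvd 2 * int p + 2 - n"
    using twist_points_divisibility[OF _ p3 D(1)] unfolding n_def by blast
  then have "2 dvd A_at (E_curve u) p \<or> 3 dvd A_at (E_curve u) p"
    unfolding A by (metis dvd_mult dvd_mult2)
  moreover have "2 dvd int k" "3 dvd int k" using k by presburger+
  ultimately have "2 dvd gcd (A_at (E_curve u) p) (int k) \<or> 3 dvd gcd (A_at (E_curve u) p) (int k)"
    by (metis gcd_greatest)
  moreover have "\<not> 2 dvd (1::int)" "\<not> 3 dvd (1::int)" by simp_all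
  ultimately show ?thesis by metis
qed

section \<open>Poles of the Lattes map\<close>

lemma of_int_poly_mult:
  "map_poly of_int (p * q) = (map_poly of_int p * map_poly of_int q :: complex poly)"
  by (rule poly_eqI) (simp add: coeff_map_poly coeff_mult)

lemma of_int_poly_add:
  "map_poly of_int (p + q) = (map_poly of_int p + map_poly of_int q :: complex poly)"
  by (rule poly_eqI) (simp add: coeff_map_poly)

lemma of_int_poly_power:
  "map_poly of_int (p ^ n) = (map_poly of_int p ^ n :: complex poly)"
  by (induction n) (simp_all add: of_int_poly_mult)

text \<open>
  By the Nullstellensatz the divisibility holds over the complex numbers; division with remainder
  by a monic polynomial does not leave the integers.
\<close>

lemma monic_dvd_power_if_roots:
  fixes f g :: "int poly"
  assumes monic: "lead_coeff f = 1"
    and roots: "\<And>x::complex. poly (map_poly of_int f) x = 0 \<Longrightarrow> poly (map_poly of_int g) x = 0"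
  shows "\<exists>n. f dvd g ^ n"
proof -
  have f0: "f \<noteq> 0" using monic by auto
  define F G :: "complex poly" where "F = map_poly of_int f" and "G = map_poly of_int g"
  have F0: "F \<noteq> 0" using f0 by (auto simp: F_def map_poly_eq_0_iff)
  have degF: "degree F = degree f" by (simp add: F_def degree_map_poly)
  have "F dvd G ^ degree F"
    using nullstellensatz_univariate[of F G] roots F0 unfolding F_def G_def by blast
  then have dv: "F dvd map_poly of_int (g ^ degree f)"
    by (simp add: degF of_int_poly_power G_def)
  obtain q r where qr: "pseudo_divmod (g ^ degree f) f = (q, r)" by fastforce
  have eq: "g ^ degree f = f * q + r" using pseudo_divmod(1)[OF f0 qr] monic by simp
  have deg: "r = 0 \<or> degree r < degree f" by (rule pseudo_divmod(2)[OF f0 qr])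
  have "F dvd map_poly of_int r"
  proof -
    have "F dvd F * map_poly of_int q + map_poly of_int r"
      using dv unfolding eq of_int_poly_add of_int_poly_mult F_def[symmetric] .
    then show ?thesis by (metis dvd_add_right_iff dvd_triv_left)
  qed
  moreover have "degree (map_poly of_int r :: complex poly) = degree r" by (simp add: degree_map_poly)
  moreover have "map_poly of_int r = (0 :: complex poly) \<longleftrightarrow> r = 0"
    by (simp add: map_poly_eq_0_iff)
  ultimately have "r = 0"
    using deg degF dvd_imp_degree_le[of F "map_poly of_int r"] by linarith
  with eq show ?thesis by (metis add.right_neutral dvd_triv_left)
qed

lemma lattes_den_zero:
  assumes L: "is_lattes_map W k L" and P: "Pt x y \<in> Qbar_points W"
    and k: "ec_mult (base_change W) k (Pt x y) = PtInf"
  shows "poly (map_poly of_int (ratfun_den L)) x = 0"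
proof -
  have "ratfun_eval L (Fin x) = Infty"
    using L P k unfolding is_lattes_map_def by (metis x_proj.simps)
  then show ?thesis by (simp add: Let_def split: if_splits)
qed

lemma lattes_at_infinity:
  assumes L: "is_lattes_map W k L"
  shows "coeff (ratfun_den L) (ratfun_degree L) = 0"
proof -
  have "ec_mult (base_change W) n PtInf = PtInf" for n by (induction n) simp_all
  moreover have "PtInf \<in> Qbar_points W" by (simp add: Qbar_points_def)
  ultimately have "ratfun_eval L (Infty :: complex proj_line) = Infty"
    using L unfolding is_lattes_map_def by (metis x_proj.simps)
  then show ?thesis by (simp add: Let_def split: if_splits)
qed

lemma poly_cong:
  fixes f :: "int poly"
  assumes "[x = y] (mod m)"
  shows "[poly f x = poly f y] (mod m)"
  by (induction f) (auto intro!: cong_add cong_mult assms)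

text \<open>
  A root of \<open>f\<close> modulo \<open>p\<close> is a pole of the reduced Lattes map, and so is infinity.
\<close>

lemma lattes_not_injective_mod:
  assumes p: "prime p" and L: "is_lattes_map W k L"
    and dvd: "int p dvd poly f x" and f: "f dvd ratfun_den L ^ n"
  shows "\<not> bij_betw (ratfun_eval_mod p L) (proj_line_mod p) (proj_line_mod p)"
proof
  define z where "z = x mod int p"
  have p0: "int p > 0" using p prime_gt_0_nat by auto
  obtain h where h: "ratfun_den L ^ n = f * h" using f by blast
  have pp: "prime (int p)" using p by simp
  have "int p dvd poly f x * poly h x" using dvd by simp
  then have "int p dvd poly (ratfun_den L) x ^ n" by (metis h poly_mult poly_power)
  then have dx: "int p dvd poly (ratfun_den L) x" using pp prime_dvd_power by blast
  have "[z = x] (mod int p)" by (simp add: z_def cong_def)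
  then have "[poly (ratfun_den L) z = poly (ratfun_den L) x] (mod int p)" by (rule poly_cong)
  then have "int p dvd poly (ratfun_den L) z" using dx cong_dvd_iff by blast
  then have "ratfun_eval_mod p L (Fin z) = Infty" by (simp add: quotient_mod_def)
  moreover have "ratfun_eval_mod p L Infty = Infty"
    using lattes_at_infinity[OF L] by (simp add: quotient_mod_def)
  moreover assume "bij_betw (ratfun_eval_mod p L) (proj_line_mod p) (proj_line_mod p)"
  then have "inj_on (ratfun_eval_mod p L) (proj_line_mod p)" by (rule bij_betw_imp_inj_on)
  moreover have "Fin z \<in> proj_line_mod p" "Infty \<in> proj_line_mod p"
    using p0 by (auto simp: proj_line_mod_def z_def)
  ultimately show False by (metis inj_onD proj_line.distinct(1))
qed

definition two_torsion_poly :: "int \<Rightarrow> int poly" where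
  "two_torsion_poly u = [:12 * u ^ 3, - 9 * u ^ 2, 0, 1:]"

definition three_torsion_poly :: "int \<Rightarrow> int poly" where
  "three_torsion_poly u = [:- 27 * u ^ 4, 48 * u ^ 3, - 18 * u ^ 2, 0, 1:]"

lemma poly_two_torsion_poly:
  "poly (map_poly of_int (two_torsion_poly u)) x = x ^ 3 - 9 * of_int u ^ 2 * x + 12 * of_int u ^ 3"
  for x :: complex
  by (simp add: two_torsion_poly_def map_poly_pCons algebra_simps power2_eq_square power3_eq_cube)

lemma poly_three_torsion_poly:
  "poly (map_poly of_int (three_torsion_poly u)) x =
    x ^ 4 - 18 * of_int u ^ 2 * x ^ 2 + 48 * of_int u ^ 3 * x - 27 * of_int u ^ 4" for x :: complex
  by (simp add: three_torsion_poly_def map_poly_pCons algebra_simps power2_eq_square power3_eq_cube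
      power4_eq_xxxx)

lemma algebraic_if_int_poly_root:
  "f \<noteq> 0 \<Longrightarrow> poly (map_poly of_int f) x = 0 \<Longrightarrow> algebraic x" for x :: complex
  by (rule algebraicI[of "map_poly of_int f"]) (auto simp: coeff_map_poly map_poly_eq_0_iff)

lemma two_torsion_point:
  assumes "poly (map_poly of_int (two_torsion_poly u)) x = 0"
  shows "Pt x 0 \<in> Qbar_points (E_curve u)"
    and "even k \<Longrightarrow> ec_mult (base_change (E_curve u)) k (Pt x 0) = PtInf"
proof -
  have "algebraic x"
    by (rule algebraic_if_int_poly_root[OF _ assms]) (simp add: two_torsion_poly_def)
  then show "Pt x 0 \<in> Qbar_points (E_curve u)"
    using assms
    by (simp add: Qbar_points_def base_change_E_curve poly_two_torsion_poly
        of_rat_mult of_rat_power of_rat_minus)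
  have "ec_mult (base_change (E_curve u)) 2 (Pt x 0) = PtInf"
    by (simp add: base_change_E_curve numeral_2_eq_2)
  then show "ec_mult (base_change (E_curve u)) k (Pt x 0) = PtInf" if "even k"
    using ec_mult_mod[of "base_change (E_curve u)" 2 "Pt x 0" k] that by simp
qed

text \<open>
  A root \<open>x\<close> of the quartic satisfies \<open>l^2 = 3 x\<close> for the slope \<open>l\<close> of the tangent, which means
  \<open>P + P = - P\<close>.
\<close>

lemma three_torsion_point:
  assumes u: "u \<noteq> 0" and root: "poly (map_poly of_int (three_torsion_poly u)) x = 0"
  obtains y where "Pt x y \<in> Qbar_points (E_curve u)"
    and "\<And>k. 3 dvd k \<Longrightarrow> ec_mult (base_change (E_curve u)) k (Pt x y) = PtInf"
proof -
  define v :: complex where "v = of_int u"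
  have v0: "v \<noteq> 0" using u by (simp add: v_def)
  have W: "base_change (E_curve u) = Weierstrass 0 0 0 (- 9 * v ^ 2) (12 * v ^ 3)"
    by (simp add: base_change_E_curve v_def of_rat_mult of_rat_power of_rat_minus)
  have q: "x ^ 4 = 18 * v ^ 2 * x ^ 2 - 48 * v ^ 3 * x + 27 * v ^ 4"
    using root by (simp add: poly_three_torsion_poly v_def algebra_simps)
  define y where "y = csqrt (x ^ 3 - 9 * v ^ 2 * x + 12 * v ^ 3)"
  have y: "y ^ 2 = x ^ 3 - 9 * v ^ 2 * x + 12 * v ^ 3" by (simp add: y_def)
  have sq: "(3 * x ^ 2 - 9 * v ^ 2) ^ 2 = 12 * x * y ^ 2"
    using q y by algebra
  have y0: "y \<noteq> 0"
  proof
    assume "y = 0"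
    then have "3 * x ^ 2 = 9 * v ^ 2" and f: "x ^ 3 - 9 * v ^ 2 * x + 12 * v ^ 3 = 0"
      using sq y by simp_all
    then have x2: "x ^ 2 = 3 * v ^ 2" by simp
    have "6 * v ^ 2 * (2 * v - x) = x ^ 3 - 9 * v ^ 2 * x + 12 * v ^ 3"
      using x2 by algebra
    then have "x = 2 * v" using f v0 by simp
    then show False using x2 v0 by (simp add: power2_eq_square)
  qed
  define l where "l = (3 * x ^ 2 - 9 * v ^ 2) / (2 * y)"
  have l: "2 * y * l = 3 * x ^ 2 + - 9 * v ^ 2" using y0 by (simp add: l_def)
  have "(2 * y) ^ 2 * l ^ 2 = (2 * y) ^ 2 * (3 * x)"
    using l sq by algebra
  then have l2: "l ^ 2 = 3 * x" using y0 by simp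
  have "ec_mult (base_change (E_curve u)) 3 (Pt x y) = PtInf"
    unfolding W using ec_add_tangent[OF y0 l]
    by (simp add: numeral_3_eq_3 l2)
  then have tors: "ec_mult (base_change (E_curve u)) k (Pt x y) = PtInf" if "3 dvd k" for k
    using ec_mult_mod[of "base_change (E_curve u)" 3 "Pt x y" k] that by (simp add: dvd_eq_mod_eq_0)
  define z where "z = y ^ 2"
  have z: "z = x ^ 3 - 9 * v ^ 2 * x + 12 * v ^ 3" by (simp add: z_def y)
  \<comment> \<open>To see that \<open>y\<close> is algebraic, \<open>z = y^2\<close> is shown to be a root of the characteristic
    polynomial of multiplication by \<open>z\<close> modulo the quartic.\<close>
  have zz: "z ^ 2 = (144) * v ^ 6 * x ^ 0 + (-216) * v ^ 5 * x ^ 1 + (108) * v ^ 4 * x ^ 2 + (-24) * v ^ 3 * x ^ 3"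
    using q z by algebra
  have zr: "z ^ 4 + 96 * v ^ 3 * z ^ 3 + 648 * v ^ 6 * z ^ 2 - 34992 * v ^ 12 = 0"
    using q z zz by algebra
  have "algebraic x"
    by (rule algebraic_if_int_poly_root[OF _ root]) (simp add: three_torsion_poly_def)
  moreover have "algebraic y"
  proof (rule algebraic_if_int_poly_root)
    show "[:- 34992 * u ^ 12, 0, 0, 0, 648 * u ^ 6, 0, 96 * u ^ 3, 0, 1:] \<noteq> 0" by simp
    have "y ^ 8 + 96 * v ^ 3 * y ^ 6 + 648 * v ^ 6 * y ^ 4 - 34992 * v ^ 12 = 0"
      using zr unfolding z_def by algebra
    then show "poly (map_poly of_int
        [:- 34992 * u ^ 12, 0, 0, 0, 648 * u ^ 6, 0, 96 * u ^ 3, 0, 1:]) y = 0"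
      by (simp add: map_poly_pCons v_def algebra_simps numeral_eq_Suc)
  qed
  moreover have "on_curve (base_change (E_curve u)) (Pt x y)" by (simp add: W y)
  ultimately have "Pt x y \<in> Qbar_points (E_curve u)" by (simp add: Qbar_points_def)
  then show ?thesis using that tors by blast
qed

lemma torsion_poly_root_mod:
  assumes "prime p" and "p > (3::int)"
  shows "\<exists>x. p dvd poly (two_torsion_poly u) x \<or> p dvd poly (three_torsion_poly u) x"
proof -
  obtain x where x: "p dvd x ^ 3 - 9 * x + 12 \<or> p dvd x ^ 4 - 18 * x ^ 2 + 48 * x - 27"
    using cubic_or_quartic_root[OF assms] by blast
  have "poly (two_torsion_poly u) (u * x) = u ^ 3 * (x ^ 3 - 9 * x + 12)"
    by (simp add: two_torsion_poly_def algebra_simps power2_eq_square power3_eq_cube)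
  moreover have "poly (three_torsion_poly u) (u * x) = u ^ 4 * (x ^ 4 - 18 * x ^ 2 + 48 * x - 27)"
    by (simp add: three_torsion_poly_def algebra_simps power2_eq_square power3_eq_cube power4_eq_xxxx)
  ultimately show ?thesis using x by (metis dvd_mult)
qed

lemma lattes_not_exceptional:
  assumes u: "u \<noteq> 0" and k: "6 dvd k" and L: "is_lattes_map (E_curve u) k L"
  shows "\<not> arithmetically_exceptional L"
proof -
  have k2: "even k" and k3: "3 dvd k" using k by (auto elim: dvdE intro: dvd_trans[of _ 6])
  have f: "\<exists>n. two_torsion_poly u dvd ratfun_den L ^ n"
  proof (rule monic_dvd_power_if_roots)
    show "lead_coeff (two_torsion_poly u) = 1" by (simp add: two_torsion_poly_def)
    fix x :: complex
    assume "poly (map_poly of_int (two_torsion_poly u)) x = 0"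
    from two_torsion_point[OF this] k2 lattes_den_zero[OF L]
    show "poly (map_poly of_int (ratfun_den L)) x = 0" by metis
  qed
  have q: "\<exists>n. three_torsion_poly u dvd ratfun_den L ^ n"
  proof (rule monic_dvd_power_if_roots)
    show "lead_coeff (three_torsion_poly u) = 1" by (simp add: three_torsion_poly_def)
    fix x :: complex
    assume "poly (map_poly of_int (three_torsion_poly u)) x = 0"
    from three_torsion_point[OF u this] k3 lattes_den_zero[OF L]
    show "poly (map_poly of_int (ratfun_den L)) x = 0" by metis
  qed
  have "{p. prime p \<and> ratfun_reduces L p \<and>
      bij_betw (ratfun_eval_mod p L) (proj_line_mod p) (proj_line_mod p)} \<subseteq> {..3}"
  proof (rule subsetI, rule ccontr)
    fix p assume p: "p \<in> {p. prime p \<and> ratfun_reduces L p \<and>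
      bij_betw (ratfun_eval_mod p L) (proj_line_mod p) (proj_line_mod p)}" "p \<notin> {..3}"
    then have "prime (int p)" "int p > 3" by auto
    then obtain x where "int p dvd poly (two_torsion_poly u) x \<or> int p dvd poly (three_torsion_poly u) x"
      using torsion_poly_root_mod by blast
    then show False using p f q lattes_not_injective_mod[OF _ L] by blast
  qed
  then show ?thesis unfolding arithmetically_exceptional_def
    using finite_subset by blast
qed

section \<open>Coprimality, exceptionality and torsion\<close>

theorem proposition18:
  fixes u :: int and k :: nat
  assumes "u \<noteq> 0" and "k > 0" and "6 dvd k"
  shows "(\<forall>p. prime p \<and> good_reduction (E_curve u) p \<longrightarrow> gcd (A_at (E_curve u) p) (int k) \<noteq> 1) \<and>
         (\<forall>L. is_lattes_map (E_curve u) k L \<longrightarrow> \<not> arithmetically_exceptional L) \<and>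
         (\<forall>P \<in> Qbar_points (E_curve u). ec_mult (base_change (E_curve u)) k P = PtInf \<longrightarrow>
            x_proj P \<notin> Fin ` \<rat>)"
proof (intro conjI allI ballI impI)
  fix p assume p: "prime p \<and> good_reduction (E_curve u) p"
  show "gcd (A_at (E_curve u) p) (int k) \<noteq> 1"
    by (rule A_at_not_coprime_6[OF conjunct1[OF p] conjunct2[OF p] assms(3)])
next
  fix L assume "is_lattes_map (E_curve u) k L"
  then show "\<not> arithmetically_exceptional L"
    by (rule lattes_not_exceptional[OF assms(1,3)])
next
  fix P assume "P \<in> Qbar_points (E_curve u)"
    and tors: "ec_mult (base_change (E_curve u)) k P = PtInf"
  then have "on_curve (base_change (E_curve u)) P"
    unfolding Qbar_points_def by (cases P) (simp_all only: on_curve.simps, blast)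
  then show "x_proj P \<notin> Fin ` \<rat>"
    by (rule torsion_x_irrational[OF assms(1,2) _ tors])
qed

end
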